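(* Let $G=(V,m,E,a)$ be an undirected weighted graph with a collection of undirected clusters $\{\hat E_i\}_{i\in I}$, $\hat E=\bigcup_{i\in I}\hat E_i$, and let $G_\beta=(V,m,E,a_\beta)$, $\beta\in[0,\infty)$, be a family of undirected graphs with $a_0=a$, such that for $\tilde\beta>\beta$ one has $a_{\tilde\beta}(i,j)=a(i,j)$ if $(i,j)\in E\setminus\hat E$ and $a_{\tilde\beta}(i,j)>a_\beta(i,j)$ if $(i,j)\in\hat E$, and such that $a_\beta(i,j)\to\infty$ as $\beta\to\infty$ for every $(i,j)\in\hat E$. Let $L_\beta$ be the graph Laplacian of $G_\beta$, and let $\underline L$ be the graph Laplacian of the reduced graph $\underline G$. Then for every $z\in\mathbb C\setminus[0,\infty)$, $$(L_\beta-zI_{\ell^2(G)})^{-1}\longrightarrow J_\uparrow(\underline L-zI_{\ell^2(\underline G)})^{-1}J_\downarrow\qquad\text{strongly as }\beta\to\infty .$$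
   Context: A weighted graph $G=(V,m,E,a)$ consists of an at most countably infinite vertex set $V$, node masses $m:V\to(0,\infty)$, a locally finite edge set $E\subseteq V\times V$, and a weight function $a:V\times V\to[0,\infty)$ with $a(v,w)>0$ iff $(v,w)\in E$. It is undirected if $E$ and $a$ are symmetric. $\ell^2(G)=\{f:V\to\mathbb C:\sum_v|f(v)|^2m(v)<\infty\}$ with $\langle f,g\rangle_{\ell^2(G)}=\sum_x\overline{f(x)}g(x)m(x)$. The graph Laplacian of an undirected graph is $[Lf](x)=\frac1{m(x)}\big(d(x)f(x)-\sum_{y}a(x,y)f(y)\big)$ with $d(x)=\sum_y a(x,y)$. Standing assumption: for each graph considered ($G$ and every $G_\beta$) there is a constant $C>0$ (possibly depending on the graph) with $d(v)\le C\,m(v)$ for all $v$; thus all Laplacians $L_\beta$ are bounded on $\ell^2(G)$. Collection of undirected clusters: a countable family of (symmetric, nonempty) edge sets $\hat E_i\subseteq E$, $i\in I$, with node sets $V_i$ (the set of vertices incident to an edge of $\hat E_i$), such that (i) $\sum_{v\in V_i}m(v)<\infty$ for each $i$; (ii) the $V_i$ are pairwise disjoint; (iii) each $(V_i,\hat E_i)$ is connected. Reduced graph $\underline G=(\underline V,\underline m,\underline E,\underline a)$: $\underline V$ is the set of connected components $C\subseteq V$ of $(V,\hat E)$ (a component may be a single vertex not incident to any edge of $\hat E$); $\underline m(C)=\sum_{v\in C}m(v)$; $\underline a(C,D)=\sum_{v\in C,\,w\in D}a(v,w)$; $\underline E=\{(C,D):\underline a(C,D)>0\}$. Its Laplacian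 $\underline L$ acts on $\ell^2(\underline G)$ by the same formula. $J_\downarrow:\ell^2(G)\to\ell^2(\underline G)$, $[J_\downarrow f](C)=\langle\chi_C,f\rangle_{\ell^2(G)}/\underline m(C)$, and $J_\uparrow:\ell^2(\underline G)\to\ell^2(G)$, $J_\uparrow\underline f=\sum_{C\in\underline V}\underline f(C)\chi_C$, where $\chi_C$ is the indicator function of $C$. *)

theory Defs
  imports "HOL-Analysis.Analysis"
begin

section \<open>Weighted graphs\<close>

record 'a wgraph =
  verts :: "'a set"
  mass :: "'a \<Rightarrow> real"
  edges :: "('a \<times> 'a) set"
  weight :: "'a \<Rightarrow> 'a \<Rightarrow> real"

definition weighted_graph :: "'a wgraph \<Rightarrow> bool" where
  "weighted_graph G \<longleftrightarrow>
     countable (verts G) \<and>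
     (\<forall>v\<in>verts G. mass G v > 0) \<and>
     edges G \<subseteq> verts G \<times> verts G \<and>
     (\<forall>v\<in>verts G. finite (edges G `` {v}) \<and> finite ((edges G)\<inverse> `` {v})) \<and>
     (\<forall>v\<in>verts G. \<forall>w\<in>verts G. weight G v w \<ge> 0 \<and> (weight G v w > 0 \<longleftrightarrow> (v, w) \<in> edges G))"

definition undirected_graph :: "'a wgraph \<Rightarrow> bool" where
  "undirected_graph G \<longleftrightarrow>
     weighted_graph G \<and> sym (edges G) \<and>
     (\<forall>v\<in>verts G. \<forall>w\<in>verts G. weight G v w = weight G w v)"

text \<open>Reduced graphs need not be locally finite, so degrees and Laplacians are
  defined by unordered infinite sums over all vertices rather than by finite sums
  over the neighbours.\<close>

definition degree :: "'a wgraph \<Rightarrow> 'a \<Rightarrow> real" where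
  "degree G v = (\<Sum>\<^sub>\<infinity>w\<in>verts G. weight G v w)"

definition degree_bounded :: "'a wgraph \<Rightarrow> bool" where
  "degree_bounded G \<longleftrightarrow> (\<exists>C>0. \<forall>v\<in>verts G. degree G v \<le> C * mass G v)"

section \<open>The weighted sequence space and its operators\<close>

text \<open>A function on the vertex set is represented by a total function vanishing off the
  vertex set, so that equality of elements of the space is equality of functions.\<close>

definition ell2 :: "'a wgraph \<Rightarrow> ('a \<Rightarrow> complex) set" where
  "ell2 G = {f. (\<forall>v. v \<notin> verts G \<longrightarrow> f v = 0) \<and>
                (\<lambda>v. (cmod (f v))\<^sup>2 * mass G v) summable_on verts G}"

definition ell2_inner :: "'a wgraph \<Rightarrow> ('a \<Rightarrow> complex) \<Rightarrow> ('a \<Rightarrow> complex) \<Rightarrow> complex" where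
  "ell2_inner G f g = (\<Sum>\<^sub>\<infinity>v\<in>verts G. cnj (f v) * g v * complex_of_real (mass G v))"

definition ell2_norm :: "'a wgraph \<Rightarrow> ('a \<Rightarrow> complex) \<Rightarrow> real" where
  "ell2_norm G f = sqrt (\<Sum>\<^sub>\<infinity>v\<in>verts G. (cmod (f v))\<^sup>2 * mass G v)"

definition bounded_operator ::
    "'a wgraph \<Rightarrow> 'b wgraph \<Rightarrow> (('a \<Rightarrow> complex) \<Rightarrow> ('b \<Rightarrow> complex)) \<Rightarrow> bool" where
  "bounded_operator G H T \<longleftrightarrow>
     (\<forall>f\<in>ell2 G. T f \<in> ell2 H) \<and>
     (\<forall>f\<in>ell2 G. \<forall>g\<in>ell2 G. T (\<lambda>v. f v + g v) = (\<lambda>w. T f w + T g w)) \<and>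
     (\<forall>c. \<forall>f\<in>ell2 G. T (\<lambda>v. c * f v) = (\<lambda>w. c * T f w)) \<and>
     (\<exists>K. \<forall>f\<in>ell2 G. ell2_norm H (T f) \<le> K * ell2_norm G f)"

text \<open>Convergence in the strong operator topology. The operators are required to be bounded:
  otherwise the norm of the difference could be a sum that does not converge, to which
  \<open>infsum\<close> assigns the value 0.\<close>

definition strongly_converges ::
    "'a wgraph \<Rightarrow> 'b wgraph \<Rightarrow> ('c \<Rightarrow> ('a \<Rightarrow> complex) \<Rightarrow> ('b \<Rightarrow> complex)) \<Rightarrow>
     (('a \<Rightarrow> complex) \<Rightarrow> ('b \<Rightarrow> complex)) \<Rightarrow> 'c filter \<Rightarrow> bool" where
  "strongly_converges G H T S F \<longleftrightarrow>
     (\<forall>\<^sub>F t in F. bounded_operator G H (T t)) \<and> bounded_operator G H S \<and>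
     (\<forall>f\<in>ell2 G. ((\<lambda>t. ell2_norm H (\<lambda>w. T t f w - S f w)) \<longlongrightarrow> 0) F)"

definition laplacian :: "'a wgraph \<Rightarrow> ('a \<Rightarrow> complex) \<Rightarrow> 'a \<Rightarrow> complex" where
  "laplacian G f x =
     (if x \<in> verts G
      then (complex_of_real (degree G x) * f x
              - (\<Sum>\<^sub>\<infinity>y\<in>verts G. complex_of_real (weight G x y) * f y)) / complex_of_real (mass G x)
      else 0)"

definition shift_op ::
    "(('a \<Rightarrow> complex) \<Rightarrow> 'a \<Rightarrow> complex) \<Rightarrow> complex \<Rightarrow> ('a \<Rightarrow> complex) \<Rightarrow> 'a \<Rightarrow> complex" where
  "shift_op T z f = (\<lambda>x. T f x - z * f x)"

text \<open>The inverse of \<open>T - z\<close> on the sequence space; it is meaningful only for \<open>z\<close> in the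
  resolvent set.\<close>

definition resolvent ::
    "'a wgraph \<Rightarrow> (('a \<Rightarrow> complex) \<Rightarrow> 'a \<Rightarrow> complex) \<Rightarrow> complex \<Rightarrow> ('a \<Rightarrow> complex) \<Rightarrow> 'a \<Rightarrow> complex" where
  "resolvent G T z = inv_into (ell2 G) (shift_op T z)"

definition resolvent_set ::
    "'a wgraph \<Rightarrow> (('a \<Rightarrow> complex) \<Rightarrow> 'a \<Rightarrow> complex) \<Rightarrow> complex set" where
  "resolvent_set G T =
     {z. bij_betw (shift_op T z) (ell2 G) (ell2 G) \<and> bounded_operator G G (resolvent G T z)}"

section \<open>Clusters and the reduced graph\<close>

text \<open>The node set of the \<open>i\<close>-th cluster is \<open>Field (Eh i)\<close>.\<close>

definition undirected_clusters :: "'a wgraph \<Rightarrow> 'i set \<Rightarrow> ('i \<Rightarrow> ('a \<times> 'a) set) \<Rightarrow> bool" where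
  "undirected_clusters G I Eh \<longleftrightarrow>
     countable I \<and>
     (\<forall>i\<in>I. Eh i \<subseteq> edges G \<and> sym (Eh i) \<and> Eh i \<noteq> {} \<and>
            mass G summable_on Field (Eh i) \<and>
            (\<forall>v\<in>Field (Eh i). \<forall>w\<in>Field (Eh i). (v, w) \<in> (Eh i)\<^sup>*)) \<and>
     disjoint_family_on (\<lambda>i. Field (Eh i)) I"

text \<open>For a symmetric edge set \<open>F\<close>, the equivalence classes of \<open>F\<^sup>*\<close> on the vertex set are the
  connected components of the graph with edge set \<open>F\<close>.\<close>

definition reduced_graph :: "'a wgraph \<Rightarrow> ('a \<times> 'a) set \<Rightarrow> 'a set wgraph" where
  "reduced_graph G F =
     (let a' = (\<lambda>C D. \<Sum>\<^sub>\<infinity>(v, w)\<in>C \<times> D. weight G v w)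
      in \<lparr> verts = verts G // F\<^sup>*,
           mass = (\<lambda>C. \<Sum>\<^sub>\<infinity>v\<in>C. mass G v),
           edges = {(C, D). C \<in> verts G // F\<^sup>* \<and> D \<in> verts G // F\<^sup>* \<and> a' C D > 0},
           weight = a' \<rparr>)"

definition J_down :: "'a wgraph \<Rightarrow> ('a \<times> 'a) set \<Rightarrow> ('a \<Rightarrow> complex) \<Rightarrow> 'a set \<Rightarrow> complex" where
  "J_down G F f C =
     (if C \<in> verts (reduced_graph G F)
      then ell2_inner G (indicator C) f / complex_of_real (mass (reduced_graph G F) C)
      else 0)"

definition J_up :: "'a wgraph \<Rightarrow> ('a \<times> 'a) set \<Rightarrow> ('a set \<Rightarrow> complex) \<Rightarrow> 'a \<Rightarrow> complex" where
  "J_up G F g v = (\<Sum>\<^sub>\<infinity>C\<in>verts (reduced_graph G F). g C * indicator C v)"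

end

theory Submission
  imports Defs
begin

text \<open>
  Multiplying \<open>\<langle>u, (L - z) u\<rangle>\<close> by a suitable \<open>\<omega> \<in> {1, \<i>, -\<i>}\<close> depending on \<open>z\<close> only makes it
  coercive with a constant \<open>\<delta>\<close> that does not depend on the graph, because \<open>\<langle>u, L u\<rangle>\<close> is half the
  Dirichlet energy of \<open>u\<close>. This yields all resolvents, and a bound \<open>1 / \<delta>\<close> on them that is uniform
  in \<open>\<beta>\<close>.

  A function \<open>u\<close> in the range of \<open>J\<^sub>\<up>\<close> is constant on clusters, so \<open>L\<^sub>\<beta> u = L u\<close> for all \<open>\<beta>\<close>, and
  \<open>J\<^sub>\<down> L J\<^sub>\<up>\<close> is the reduced Laplacian. With \<open>u = J\<^sub>\<up> (L\<^sub>r - z)\<inverse> J\<^sub>\<down> f\<close>, where \<open>L\<^sub>r\<close> is the reduced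
  Laplacian, the difference of the resolvents applied to \<open>f\<close> is therefore
  \<open>v\<^sub>\<beta> = (L\<^sub>\<beta> - z)\<inverse> w\<close> with \<open>w = f - (L - z) u\<close>, and \<open>w\<close> has average zero on every cluster.

  The energy of \<open>v\<^sub>\<beta>\<close> is bounded in \<open>\<beta>\<close>, so the diverging weights force \<open>v\<^sub>\<beta>(i) - v\<^sub>\<beta>(j) \<rightarrow> 0\<close> for \<open>i\<close>, \<open>j\<close>
  in one cluster, and \<open>v\<^sub>\<beta>\<close> minus its cluster averages is bounded and tends to 0 pointwise, hence
  weakly. As \<open>w\<close> is orthogonal to the cluster averages, \<open>\<langle>w, v\<^sub>\<beta>\<rangle> \<rightarrow> 0\<close>, and coercivity gives
  \<open>\<delta> \<parallel>v\<^sub>\<beta>\<parallel>\<^sup>2 \<le> \<bar>\<langle>w, v\<^sub>\<beta>\<rangle>\<bar> \<rightarrow> 0\<close>.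
\<close>

section \<open>The weighted sequence space\<close>

text \<open>Finite partial sums obey the inequality for \<open>L2_set\<close>, with a bound that
  does not depend on the finite set. Terms being nonnegative, this gives summability and the bound
  on the infinite sum.\<close>

lemma cauchy_schwarz_infsum:
  fixes f g :: "'b \<Rightarrow> real"
  assumes f: "(\<lambda>x. (f x)\<^sup>2) summable_on A" and g: "(\<lambda>x. (g x)\<^sup>2) summable_on A"
  shows "(\<lambda>x. \<bar>f x\<bar> * \<bar>g x\<bar>) summable_on A"
    and "(\<Sum>\<^sub>\<infinity>x\<in>A. \<bar>f x\<bar> * \<bar>g x\<bar>) \<le> sqrt (\<Sum>\<^sub>\<infinity>x\<in>A. (f x)\<^sup>2) * sqrt (\<Sum>\<^sub>\<infinity>x\<in>A. (g x)\<^sup>2)"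
proof -
  have *: "(\<Sum>x\<in>F. \<bar>f x\<bar> * \<bar>g x\<bar>) \<le> sqrt (\<Sum>\<^sub>\<infinity>x\<in>A. (f x)\<^sup>2) * sqrt (\<Sum>\<^sub>\<infinity>x\<in>A. (g x)\<^sup>2)"
    if "finite F" "F \<subseteq> A" for F
  proof -
    have "(\<Sum>x\<in>F. \<bar>f x\<bar> * \<bar>g x\<bar>) \<le> L2_set f F * L2_set g F"
      by (rule L2_set_mult_ineq)
    also have "\<dots> \<le> sqrt (\<Sum>\<^sub>\<infinity>x\<in>A. (f x)\<^sup>2) * sqrt (\<Sum>\<^sub>\<infinity>x\<in>A. (g x)\<^sup>2)"
      unfolding L2_set_def
      by (intro mult_mono real_sqrt_le_mono finite_sum_le_infsum f g that)
        (auto intro!: infsum_nonneg sum_nonneg)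
    finally show ?thesis .
  qed
  show s: "(\<lambda>x. \<bar>f x\<bar> * \<bar>g x\<bar>) summable_on A"
    by (rule nonneg_bdd_above_summable_on) (auto intro!: bdd_aboveI2 * simp: mult.commute)
  show "(\<Sum>\<^sub>\<infinity>x\<in>A. \<bar>f x\<bar> * \<bar>g x\<bar>) \<le> sqrt (\<Sum>\<^sub>\<infinity>x\<in>A. (f x)\<^sup>2) * sqrt (\<Sum>\<^sub>\<infinity>x\<in>A. (g x)\<^sup>2)"
    by (rule infsum_le_finite_sums[OF s]) (use * in blast)
qed

lemma cmod_infsum_le_infsum:
  fixes f :: "'b \<Rightarrow> complex" and g :: "'b \<Rightarrow> real"
  assumes "g summable_on A" "\<And>x. x \<in> A \<Longrightarrow> cmod (f x) \<le> g x"
  shows "f summable_on A" "cmod (infsum f A) \<le> infsum g A"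
proof -
  have a: "(\<lambda>x. cmod (f x)) summable_on A"
    by (rule summable_on_comparison_test[OF assms(1)]) (use assms(2) in auto)
  then show "f summable_on A" by (rule abs_summable_summable)
  have "cmod (infsum f A) \<le> (\<Sum>\<^sub>\<infinity>x\<in>A. cmod (f x))"
    by (rule norm_infsum_bound) (use a in auto)
  also have "\<dots> \<le> infsum g A" using a assms by (intro infsum_mono) auto
  finally show "cmod (infsum f A) \<le> infsum g A" .
qed

lemma cmod_diff_power2_le: "(cmod (a - b))\<^sup>2 \<le> 2 * (cmod a)\<^sup>2 + 2 * (cmod b)\<^sup>2"
proof -
  have "(cmod (a - b))\<^sup>2 \<le> (cmod a + cmod b)\<^sup>2" by (intro power_mono norm_triangle_ineq4) auto
  also have "\<dots> \<le> 2 * (cmod a)\<^sup>2 + 2 * (cmod b)\<^sup>2"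
    using sum_squares_bound[of "cmod a" "cmod b"] by (simp add: power2_sum)
  finally show ?thesis .
qed

text \<open>The reduced graph may fail to be locally finite and hence to be a
  \<open>weighted_graph\<close>. What concerns the sequence space alone is therefore developed from
  the positivity of the masses, for \<open>G\<close> and the reduced graph alike.\<close>

locale positive_masses =
  fixes G :: "'a wgraph"
  assumes mass_pos: "v \<in> verts G \<Longrightarrow> mass G v > 0"
begin

lemma mass_nonneg [simp]: "v \<in> verts G \<Longrightarrow> 0 \<le> mass G v"
  using mass_pos by (simp add: less_imp_le)

lemma ell2_vanishes: "f \<in> ell2 G \<Longrightarrow> v \<notin> verts G \<Longrightarrow> f v = 0"
  by (simp add: ell2_def)

lemma ell2_summable: "f \<in> ell2 G \<Longrightarrow> (\<lambda>v. (cmod (f v))\<^sup>2 * mass G v) summable_on verts G"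
  by (simp add: ell2_def)

lemma ell2_norm_nonneg [simp]: "ell2_norm G f \<ge> 0"
  unfolding ell2_norm_def by (auto intro!: infsum_nonneg)

lemma ell2_norm_power2: "(ell2_norm G f)\<^sup>2 = (\<Sum>\<^sub>\<infinity>v\<in>verts G. (cmod (f v))\<^sup>2 * mass G v)"
  unfolding ell2_norm_def by (auto intro!: real_sqrt_pow2 infsum_nonneg)

text \<open>Multiplying by the square root of the mass turns the weighted norm on a finite set into
  a Euclidean one, to which the inequalities for \<open>L2_set\<close> apply.\<close>

lemma L2_set_mass:
  assumes "F \<subseteq> verts G"
  shows "L2_set (\<lambda>v. cmod (f v) * sqrt (mass G v)) F = sqrt (\<Sum>v\<in>F. (cmod (f v))\<^sup>2 * mass G v)"
  unfolding L2_set_def using assms mass_pos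
  by (auto intro!: sum.cong simp: power_mult_distrib less_imp_le subset_eq)

lemma L2_set_le_ell2_norm:
  assumes "f \<in> ell2 G" "F \<subseteq> verts G"
  shows "L2_set (\<lambda>v. cmod (f v) * sqrt (mass G v)) F \<le> ell2_norm G f"
proof (cases "finite F")
  case True
  then show ?thesis
    unfolding L2_set_mass[OF assms(2)] ell2_norm_def
    using assms(2) by (intro real_sqrt_le_mono finite_sum_le_infsum ell2_summable assms) auto
qed simp

text \<open>Partial sums of nonnegative terms determine the infinite sum. Together with
  \<open>L2_set_le_ell2_norm\<close> this lets the triangle inequality and completeness be checked
  on finite sets of vertices.\<close>

lemma ell2_if_bounded_L2_set:
  assumes "\<And>v. v \<notin> verts G \<Longrightarrow> f v = 0"
    and "\<And>F. finite F \<Longrightarrow> F \<subseteq> verts G \<Longrightarrow> L2_set (\<lambda>v. cmod (f v) * sqrt (mass G v)) F \<le> B"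
  shows "f \<in> ell2 G" "ell2_norm G f \<le> B"
proof -
  have B: "B \<ge> 0" using assms(2)[of "{}"] by simp
  have *: "(\<Sum>v\<in>F. (cmod (f v))\<^sup>2 * mass G v) \<le> B\<^sup>2" if "finite F" "F \<subseteq> verts G" for F
    using assms(2)[OF that] unfolding L2_set_mass[OF that(2)] by (rule sqrt_le_D)
  have "(\<lambda>v. (cmod (f v))\<^sup>2 * mass G v) summable_on verts G"
    by (rule nonneg_bdd_above_summable_on)
      (auto intro!: bdd_aboveI2 *)
  then show f: "f \<in> ell2 G" using assms(1) by (simp add: ell2_def)
  show "ell2_norm G f \<le> B"
    unfolding ell2_norm_def using B
    by (intro real_le_lsqrt infsum_le_finite_sums[OF ell2_summable[OF f]] *) auto
qed

lemma ell2_0 [simp]: "(\<lambda>_. 0) \<in> ell2 G"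
  by (simp add: ell2_def)

lemma
  assumes "f \<in> ell2 G" "g \<in> ell2 G"
  shows ell2_add: "(\<lambda>v. f v + g v) \<in> ell2 G"
    and ell2_norm_triangle: "ell2_norm G (\<lambda>v. f v + g v) \<le> ell2_norm G f + ell2_norm G g"
proof -
  have "L2_set (\<lambda>v. cmod (f v + g v) * sqrt (mass G v)) F \<le> ell2_norm G f + ell2_norm G g"
    if F: "finite F" "F \<subseteq> verts G" for F
  proof -
    have "L2_set (\<lambda>v. cmod (f v + g v) * sqrt (mass G v)) F
        \<le> L2_set (\<lambda>v. cmod (f v) * sqrt (mass G v) + cmod (g v) * sqrt (mass G v)) F"
      using F by (intro L2_set_mono)
        (auto simp: subset_eq simp flip: distrib_right intro!: mult_right_mono norm_triangle_ineq)
    also have "\<dots> \<le> L2_set (\<lambda>v. cmod (f v) * sqrt (mass G v)) F + L2_set (\<lambda>v. cmod (g v) * sqrt (mass G v)) F"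
      by (rule L2_set_triangle_ineq)
    also have "\<dots> \<le> ell2_norm G f + ell2_norm G g"
      by (intro add_mono L2_set_le_ell2_norm assms F)
    finally show ?thesis .
  qed
  note * = this and vanish = ell2_vanishes[OF assms(1)] ell2_vanishes[OF assms(2)]
  show "(\<lambda>v. f v + g v) \<in> ell2 G"
    by (rule ell2_if_bounded_L2_set(1)[OF _ *]) (simp_all add: vanish)
  show "ell2_norm G (\<lambda>v. f v + g v) \<le> ell2_norm G f + ell2_norm G g"
    by (rule ell2_if_bounded_L2_set(2)[OF _ *]) (simp_all add: vanish)
qed

lemma ell2_scale: "f \<in> ell2 G \<Longrightarrow> (\<lambda>v. c * f v) \<in> ell2 G"
  by (auto simp: ell2_def norm_mult power_mult_distrib mult.assoc intro!: summable_on_cmult_right)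

lemma ell2_norm_scale: "ell2_norm G (\<lambda>v. c * f v) = cmod c * ell2_norm G f"
  by (simp add: ell2_norm_def norm_mult power_mult_distrib mult.assoc infsum_cmult_right' real_sqrt_mult)

lemma
  assumes "f \<in> ell2 G" "g \<in> ell2 G"
  shows ell2_diff: "(\<lambda>v. f v - g v) \<in> ell2 G"
    and ell2_norm_diff_triangle: "ell2_norm G (\<lambda>v. f v - g v) \<le> ell2_norm G f + ell2_norm G g"
  using ell2_add[OF assms(1) ell2_scale[OF assms(2), of "-1"]]
    ell2_norm_triangle[OF assms(1) ell2_scale[OF assms(2), of "-1"]] ell2_norm_scale[of "-1" g]
  by simp_all

lemma ell2_norm_commute: "ell2_norm G (\<lambda>v. f v - g v) = ell2_norm G (\<lambda>v. g v - f v)"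
  by (simp add: ell2_norm_def norm_minus_commute)

lemma ell2_norm_0 [simp]: "ell2_norm G (\<lambda>_. 0) = 0"
  by (simp add: ell2_norm_def)

text \<open>A single vertex has positive mass, so evaluation at it is continuous.\<close>

lemma ell2_pointwise:
  assumes "f \<in> ell2 G" "v \<in> verts G"
  shows "cmod (f v) * sqrt (mass G v) \<le> ell2_norm G f"
  using L2_set_le_ell2_norm[of f "{v}"] assms mass_pos[of v] by auto

lemma ell2_norm_eq_0:
  assumes "f \<in> ell2 G" "ell2_norm G f = 0"
  shows "f = (\<lambda>_. 0)"
proof
  fix v show "f v = 0"
    using ell2_pointwise[OF assms(1), of v] assms ell2_vanishes mass_pos[of v]
    by (cases "v \<in> verts G") (auto simp: mult_le_0_iff)
qed

section \<open>Inner product and completeness\<close>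

lemma
  assumes "f \<in> ell2 G" "g \<in> ell2 G"
  shows ell2_inner_summable: "(\<lambda>v. cnj (f v) * g v * complex_of_real (mass G v)) summable_on verts G"
    and ell2_cauchy_schwarz: "cmod (ell2_inner G f g) \<le> ell2_norm G f * ell2_norm G g"
proof -
  have sq: "(\<lambda>v. (cmod (h v) * sqrt (mass G v))\<^sup>2) summable_on verts G"
    "(\<Sum>\<^sub>\<infinity>v\<in>verts G. (cmod (h v) * sqrt (mass G v))\<^sup>2) = (\<Sum>\<^sub>\<infinity>v\<in>verts G. (cmod (h v))\<^sup>2 * mass G v)"
    if "h \<in> ell2 G" for h
    using ell2_summable[OF that] mass_pos
    by (auto simp: power_mult_distrib less_imp_le cong: summable_on_cong infsum_cong)
  note cs = cauchy_schwarz_infsum[OF sq(1)[OF assms(1)] sq(1)[OF assms(2)]]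
  have le: "cmod (cnj (f v) * g v * complex_of_real (mass G v))
      \<le> \<bar>cmod (f v) * sqrt (mass G v)\<bar> * \<bar>cmod (g v) * sqrt (mass G v)\<bar>" if "v \<in> verts G" for v
    using mass_pos[OF that] real_sqrt_mult_self[of "mass G v"] by (simp add: norm_mult algebra_simps)
  show "(\<lambda>v. cnj (f v) * g v * complex_of_real (mass G v)) summable_on verts G"
    by (rule cmod_infsum_le_infsum(1)[OF cs(1) le])
  show "cmod (ell2_inner G f g) \<le> ell2_norm G f * ell2_norm G g"
    using cmod_infsum_le_infsum(2)[OF cs(1) le] cs(2)
    unfolding sq(2)[OF assms(1)] sq(2)[OF assms(2)] ell2_inner_def ell2_norm_def by linarith
qed

lemma ell2_inner_add_right:
  assumes "f \<in> ell2 G" "g \<in> ell2 G" "h \<in> ell2 G"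
  shows "ell2_inner G f (\<lambda>v. g v + h v) = ell2_inner G f g + ell2_inner G f h"
  using infsum_add[OF ell2_inner_summable[OF assms(1,2)] ell2_inner_summable[OF assms(1,3)]]
  by (simp add: ell2_inner_def algebra_simps)

lemma ell2_inner_scale_right: "ell2_inner G f (\<lambda>v. c * g v) = c * ell2_inner G f g"
  unfolding ell2_inner_def by (subst infsum_cmult_right'[symmetric]) (simp add: algebra_simps)

lemma ell2_inner_diff_right:
  assumes "f \<in> ell2 G" "g \<in> ell2 G" "h \<in> ell2 G"
  shows "ell2_inner G f (\<lambda>v. g v - h v) = ell2_inner G f g - ell2_inner G f h"
  using ell2_inner_add_right[OF assms(1,2) ell2_scale[OF assms(3), of "-1"]]
    ell2_inner_scale_right[of f "-1" h] by simp

lemma ell2_inner_commute: "ell2_inner G g f = cnj (ell2_inner G f g)"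
  unfolding ell2_inner_def infsum_cnj[symmetric] by (simp add: algebra_simps)

lemma ell2_inner_self:
  assumes "f \<in> ell2 G"
  shows "ell2_inner G f f = complex_of_real ((ell2_norm G f)\<^sup>2)"
proof -
  have "((\<lambda>v. complex_of_real ((cmod (f v))\<^sup>2 * mass G v)) has_sum
      complex_of_real ((ell2_norm G f)\<^sup>2)) (verts G)"
    unfolding ell2_norm_power2 by (intro has_sum_of_real has_sum_infsum ell2_summable assms)
  then show ?thesis
    unfolding ell2_inner_def by (intro infsumI) (simp only: of_real_mult complex_norm_square mult.commute)
qed

lemma ell2_norm_diff_power2:
  assumes "f \<in> ell2 G" "g \<in> ell2 G"
  shows "(ell2_norm G (\<lambda>v. f v - g v))\<^sup>2
    = (ell2_norm G f)\<^sup>2 - 2 * Re (ell2_inner G f g) + (ell2_norm G g)\<^sup>2"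
proof -
  note fg = ell2_diff[OF assms]
  let ?d = "\<lambda>v. f v - g v"
  have "complex_of_real ((ell2_norm G ?d)\<^sup>2) = ell2_inner G ?d f - ell2_inner G ?d g"
    unfolding ell2_inner_self[OF fg, symmetric] by (rule ell2_inner_diff_right) (use fg assms in auto)
  also have "ell2_inner G ?d f = cnj (ell2_inner G f f - ell2_inner G f g)"
    by (subst ell2_inner_commute) (simp add: ell2_inner_diff_right assms)
  also have "ell2_inner G ?d g = cnj (ell2_inner G g f - ell2_inner G g g)"
    by (subst ell2_inner_commute) (simp add: ell2_inner_diff_right assms)
  finally have "Re (complex_of_real ((ell2_norm G ?d)\<^sup>2)) =
     Re (cnj (ell2_inner G f f - ell2_inner G f g) - cnj (ell2_inner G g f - ell2_inner G g g))"
    by simp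
  then show ?thesis using ell2_inner_commute[of g f] by (simp add: ell2_inner_self assms)
qed

text \<open>Evaluation is continuous, so a Cauchy sequence converges pointwise. On a finite set of
  vertices the Cauchy bound survives the passage to the limit in one index; being the same for all
  finite sets, it controls the distance to the limit.\<close>

lemma ell2_complete:
  fixes s :: "nat \<Rightarrow> 'a \<Rightarrow> complex"
  assumes s: "\<And>n. s n \<in> ell2 G"
    and C: "\<And>e. e > 0 \<Longrightarrow> \<exists>N. \<forall>m\<ge>N. \<forall>n\<ge>N. ell2_norm G (\<lambda>v. s m v - s n v) < e"
  obtains f where "f \<in> ell2 G" "(\<lambda>n. ell2_norm G (\<lambda>v. s n v - f v)) \<longlonglongrightarrow> 0"
proof -
  have "\<exists>l. (\<lambda>n. s n v) \<longlonglongrightarrow> l" for v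
  proof (cases "v \<in> verts G")
    case True
    have "Cauchy (\<lambda>n. s n v)"
    proof (rule metric_CauchyI)
      fix e :: real assume "e > 0"
      then obtain N where N: "\<And>m n. m \<ge> N \<Longrightarrow> n \<ge> N \<Longrightarrow>
          ell2_norm G (\<lambda>v. s m v - s n v) < e * sqrt (mass G v)"
        using C[of "e * sqrt (mass G v)"] mass_pos[OF True] by auto
      have "dist (s m v) (s n v) < e" if "m \<ge> N" "n \<ge> N" for m n
      proof -
        have "cmod (s m v - s n v) * sqrt (mass G v) < e * sqrt (mass G v)"
          using ell2_pointwise[OF ell2_diff[OF s s] True, of m n] N[OF that] by linarith
        then show ?thesis using mass_pos[OF True] by (simp add: dist_norm)
      qed
      then show "\<exists>N. \<forall>m\<ge>N. \<forall>n\<ge>N. dist (s m v) (s n v) < e" by blast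
    qed
    then show ?thesis by (simp add: Cauchy_convergent_iff convergent_def)
  qed (use ell2_vanishes[OF s] in auto)
  then obtain f where f: "\<And>v. (\<lambda>n. s n v) \<longlonglongrightarrow> f v" by metis
  have f0: "f v = 0" if "v \<notin> verts G" for v
    using f[of v] ell2_vanishes[OF s that] by (simp add: LIMSEQ_const_iff)
  have *: "(\<lambda>v. s n v - f v) \<in> ell2 G \<and> ell2_norm G (\<lambda>v. s n v - f v) \<le> e"
    if N: "\<And>m n. m \<ge> N \<Longrightarrow> n \<ge> N \<Longrightarrow> ell2_norm G (\<lambda>v. s m v - s n v) < e" and n: "n \<ge> N" for n N e
  proof -
    have "L2_set (\<lambda>v. cmod (s n v - f v) * sqrt (mass G v)) F \<le> e"
      if F: "finite F" "F \<subseteq> verts G" for F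
    proof (rule LIMSEQ_le_const2)
      show "(\<lambda>m. L2_set (\<lambda>v. cmod (s n v - s m v) * sqrt (mass G v)) F)
          \<longlonglongrightarrow> L2_set (\<lambda>v. cmod (s n v - f v) * sqrt (mass G v)) F"
        unfolding L2_set_def by (intro tendsto_intros f)
      show "\<exists>M. \<forall>m\<ge>M. L2_set (\<lambda>v. cmod (s n v - s m v) * sqrt (mass G v)) F \<le> e"
      proof (intro exI allI impI)
        fix m assume "m \<ge> N"
        then show "L2_set (\<lambda>v. cmod (s n v - s m v) * sqrt (mass G v)) F \<le> e"
          using L2_set_le_ell2_norm[OF ell2_diff[OF s s] F(2), of n m] N[OF n, of m] by linarith
      qed
    qed
    then show ?thesis using ell2_if_bounded_L2_set[of "\<lambda>v. s n v - f v" e] f0 ell2_vanishes[OF s] by auto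
  qed
  obtain N where "\<And>m n. m \<ge> N \<Longrightarrow> n \<ge> N \<Longrightarrow> ell2_norm G (\<lambda>v. s m v - s n v) < 1"
    using C[of 1] by auto
  from *[OF this order_refl] have "(\<lambda>v. s N v - f v) \<in> ell2 G" by simp
  from ell2_diff[OF s[of N] this] have "f \<in> ell2 G" by simp
  moreover have "(\<lambda>n. ell2_norm G (\<lambda>v. s n v - f v)) \<longlonglongrightarrow> 0"
  proof (rule LIMSEQ_I)
    fix e :: real assume "e > 0"
    then obtain N where "\<And>m n. m \<ge> N \<Longrightarrow> n \<ge> N \<Longrightarrow> ell2_norm G (\<lambda>v. s m v - s n v) < e/2"
      using C[of "e/2"] by auto
    from *[OF this] have "\<And>n. n \<ge> N \<Longrightarrow> norm (ell2_norm G (\<lambda>v. s n v - f v) - 0) < e"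
      using \<open>e > 0\<close> by fastforce
    then show "\<exists>N. \<forall>n\<ge>N. norm (ell2_norm G (\<lambda>v. s n v - f v) - 0) < e" by blast
  qed
  ultimately show ?thesis using that by blast
qed

end

section \<open>Coercive operators\<close>

context positive_masses
begin

text \<open>Banach's fixed point argument: the iterates of \<open>S\<close> from 0 have
  geometrically decreasing steps, so they form a Cauchy sequence, and by the contraction property
  the limit is fixed.\<close>

lemma ell2_contraction_fixpoint:
  assumes S: "\<And>u. u \<in> ell2 G \<Longrightarrow> S u \<in> ell2 G" and q: "0 \<le> q" "q < 1"
    and contr: "\<And>u v. u \<in> ell2 G \<Longrightarrow> v \<in> ell2 G \<Longrightarrow>
      ell2_norm G (\<lambda>x. S u x - S v x) \<le> q * ell2_norm G (\<lambda>x. u x - v x)"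
  obtains u where "u \<in> ell2 G" "S u = u"
proof -
  define s where "s n = (S ^^ n) (\<lambda>_. 0)" for n
  have s: "s n \<in> ell2 G" for n
    by (induction n) (auto simp: s_def S)
  have s_Suc: "s (Suc n) = S (s n)" for n by (simp add: s_def)
  define D where "D = ell2_norm G (\<lambda>x. s 1 x - s 0 x)"
  have step: "ell2_norm G (\<lambda>x. s (Suc n) x - s n x) \<le> q ^ n * D" for n
  proof (induction n)
    case (Suc n)
    have "ell2_norm G (\<lambda>x. s (Suc (Suc n)) x - s (Suc n) x) \<le> q * ell2_norm G (\<lambda>x. s (Suc n) x - s n x)"
      unfolding s_Suc[of "Suc n"] s_Suc[of n] using contr[OF s[of "Suc n"] s[of n]] s_Suc by simp
    also have "\<dots> \<le> q * (q ^ n * D)" by (intro mult_left_mono Suc q)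
    finally show ?case by simp
  qed (simp add: D_def)
  have far: "ell2_norm G (\<lambda>x. s (n + k) x - s n x) \<le> q ^ n * D / (1 - q)" for n k
  proof -
    have "ell2_norm G (\<lambda>x. s (n + k) x - s n x) \<le> (\<Sum>i<k. q ^ (n + i) * D)"
    proof (induction k)
      case (Suc k)
      have "ell2_norm G (\<lambda>x. (s (Suc (n + k)) x - s (n + k) x) + (s (n + k) x - s n x))
          \<le> q ^ (n + k) * D + (\<Sum>i<k. q ^ (n + i) * D)"
        by (rule order_trans[OF ell2_norm_triangle add_mono[OF step Suc]]) (intro ell2_diff s)+
      then show ?case by simp
    qed simp
    also have "\<dots> = q ^ n * D * (\<Sum>i<k. q ^ i)"
      by (simp add: sum_distrib_left power_add mult_ac)
    also have "\<dots> \<le> q ^ n * D * (1 / (1 - q))"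
    proof (intro mult_left_mono)
      show "(\<Sum>i<k. q ^ i) \<le> 1 / (1 - q)"
        using q by (simp add: sum_gp_strict divide_right_mono)
    qed (use q in \<open>auto simp: D_def\<close>)
    finally show ?thesis by simp
  qed
  have lim0: "(\<lambda>n. q ^ n * D / (1 - q)) \<longlonglongrightarrow> 0"
    using q by (auto intro!: tendsto_eq_intros LIMSEQ_power_zero)
  have Cauchy: "\<exists>N. \<forall>m\<ge>N. \<forall>n\<ge>N. ell2_norm G (\<lambda>x. s m x - s n x) < e" if e: "e > 0" for e
  proof -
    obtain N where N: "\<And>n. n \<ge> N \<Longrightarrow> q ^ n * D / (1 - q) < e"
      using order_tendstoD(2)[OF lim0 e] by (auto simp: eventually_sequentially)
    have less: "ell2_norm G (\<lambda>x. s m x - s n x) < e" if "n \<ge> N" "m \<ge> n" for m n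
      using far[of n "m - n"] N[OF that(1)] that(2) by simp
    then show ?thesis by (metis ell2_norm_commute nle_le)
  qed
  obtain u where u: "u \<in> ell2 G" "(\<lambda>n. ell2_norm G (\<lambda>x. s n x - u x)) \<longlonglongrightarrow> 0"
    using ell2_complete[OF s Cauchy] by blast
  have "ell2_norm G (\<lambda>x. S u x - u x) \<le> q * ell2_norm G (\<lambda>x. s n x - u x) + ell2_norm G (\<lambda>x. s (Suc n) x - u x)" for n
  proof -
    have "ell2_norm G (\<lambda>x. (S u x - S (s n) x) + (s (Suc n) x - u x))
       \<le> q * ell2_norm G (\<lambda>x. u x - s n x) + ell2_norm G (\<lambda>x. s (Suc n) x - u x)"
      by (rule order_trans[OF ell2_norm_triangle add_right_mono[OF contr]]) (intro ell2_diff s S u)+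
    then show ?thesis by (simp add: s_Suc ell2_norm_commute[of u])
  qed
  moreover have "(\<lambda>n. q * ell2_norm G (\<lambda>x. s n x - u x) + ell2_norm G (\<lambda>x. s (Suc n) x - u x)) \<longlonglongrightarrow> q * 0 + 0"
    by (intro tendsto_intros u(2) LIMSEQ_Suc[OF u(2)])
  ultimately have "ell2_norm G (\<lambda>x. S u x - u x) \<le> 0"
    by (intro LIMSEQ_le_const) auto
  then have "(\<lambda>x. S u x - u x) = (\<lambda>_. 0)"
    using ell2_norm_nonneg[of "\<lambda>x. S u x - u x"] by (intro ell2_norm_eq_0 ell2_diff S u) linarith
  then have "S u = u" by (simp add: fun_eq_iff)
  with u(1) that show ?thesis by blast
qed

lemma bounded_operator_diff:
  assumes "bounded_operator G H T" "f \<in> ell2 G" "g \<in> ell2 G"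
  shows "T (\<lambda>x. f x - g x) = (\<lambda>x. T f x - T g x)"
proof -
  have add: "T (\<lambda>x. f x + g x) = (\<lambda>x. T f x + T g x)" if "g \<in> ell2 G" for g
    using assms that unfolding bounded_operator_def by blast
  have scale: "T (\<lambda>x. c * g x) = (\<lambda>x. c * T g x)" for c
    using assms unfolding bounded_operator_def by blast
  show ?thesis
    using add[OF ell2_scale[OF assms(3), of "-1"]] scale[of "-1"] by simp
qed

text \<open>The Lax-Milgram argument. Coercivity and Cauchy-Schwarz give the lower bound, hence
  injectivity and the bound \<open>1 / \<delta>\<close> on the inverse. For surjectivity,
  \<open>T u = f\<close> is rewritten as a fixed point equation for the map taking \<open>u\<close>
  to \<open>u - c * (T u - f)\<close> with a suitable \<open>c\<close>.\<close>

lemma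
  assumes T: "bounded_operator G G T" and \<delta>: "\<delta> > 0" and \<omega>: "cmod \<omega> = 1"
    and coercive: "\<And>u. u \<in> ell2 G \<Longrightarrow> \<delta> * (ell2_norm G u)\<^sup>2 \<le> Re (\<omega> * ell2_inner G u (T u))"
  shows coercive_bij_betw: "bij_betw T (ell2 G) (ell2 G)"
    and coercive_lower_bound: "u \<in> ell2 G \<Longrightarrow> \<delta> * ell2_norm G u \<le> ell2_norm G (T u)"
    and coercive_inverse_bounded: "bounded_operator G G (inv_into (ell2 G) T)"
proof -
  have T_in: "T u \<in> ell2 G" if "u \<in> ell2 G" for u
    using T that unfolding bounded_operator_def by blast
  show lower: "\<delta> * ell2_norm G u \<le> ell2_norm G (T u)" if u: "u \<in> ell2 G" for u
  proof (cases "ell2_norm G u = 0")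
    case False
    have "\<delta> * (ell2_norm G u)\<^sup>2 \<le> cmod (\<omega> * ell2_inner G u (T u))"
      using coercive[OF u] complex_Re_le_cmod order_trans by blast
    also have "\<dots> \<le> ell2_norm G u * ell2_norm G (T u)"
      using ell2_cauchy_schwarz[OF u T_in[OF u]] by (simp add: norm_mult \<omega>)
    finally have "ell2_norm G u * (\<delta> * ell2_norm G u) \<le> ell2_norm G u * ell2_norm G (T u)"
      by (simp add: power2_eq_square mult_ac)
    then show ?thesis using False ell2_norm_nonneg[of u] mult_le_cancel_left_pos[of "ell2_norm G u"] by simp
  qed simp
  have inj: "inj_on T (ell2 G)"
  proof (rule inj_onI)
    fix u v assume uv: "u \<in> ell2 G" "v \<in> ell2 G" "T u = T v"
    have "\<delta> * ell2_norm G (\<lambda>x. u x - v x) \<le> 0"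
      using lower[OF ell2_diff[OF uv(1,2)]] bounded_operator_diff[OF T uv(1,2)] uv(3) by simp
    then have "ell2_norm G (\<lambda>x. u x - v x) = 0"
      using \<delta> ell2_norm_nonneg[of "\<lambda>x. u x - v x"] by (simp add: mult_le_0_iff)
    then have "(\<lambda>x. u x - v x) = (\<lambda>_. 0)" by (intro ell2_norm_eq_0 ell2_diff uv)
    then show "u = v" by (simp add: fun_eq_iff)
  qed
  obtain K0 where K0: "\<And>u. u \<in> ell2 G \<Longrightarrow> ell2_norm G (T u) \<le> K0 * ell2_norm G u"
    using T unfolding bounded_operator_def by blast
  \<comment> \<open>The maximum ensures \<open>\<delta> \<le> K\<close>, so that \<open>q\<close>
    below is the square root of a nonnegative number.\<close>
  define K where "K = max K0 \<delta>"
  have K: "K \<ge> \<delta>" "K > 0" using \<delta> by (auto simp: K_def)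
  have TK: "ell2_norm G (T u) \<le> K * ell2_norm G u" if "u \<in> ell2 G" for u
    using order_trans[OF K0[OF that] mult_right_mono[of K0 K "ell2_norm G u"]] by (auto simp: K_def)
  have surj: "f \<in> T ` ell2 G" if f: "f \<in> ell2 G" for f
  proof -
    \<comment> \<open>For \<open>c = t * \<omega>\<close> with \<open>t \<ge> 0\<close> the squared
      contraction factor is at most \<open>1 - 2 * t * \<delta> + t\<^sup>2 * K\<^sup>2\<close>.
      This is smallest at \<open>t = \<delta> / K\<^sup>2\<close>, where it equals
      \<open>q\<^sup>2\<close>.\<close>
    define c where "c = complex_of_real (\<delta> / K\<^sup>2) * \<omega>"
    define q where "q = sqrt (1 - (\<delta> / K)\<^sup>2)"
    have ratio: "0 < \<delta> / K" "\<delta> / K \<le> 1" using \<delta> K by auto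
    then have q2: "q\<^sup>2 = 1 - (\<delta> / K)\<^sup>2" and q: "0 \<le> q" "q < 1"
      unfolding q_def by (auto simp: power_le_one)
    define S where "S u = (\<lambda>x. u x - c * (T u x - f x))" for u
    have S: "S u \<in> ell2 G" if "u \<in> ell2 G" for u
      unfolding S_def by (intro ell2_diff ell2_scale T_in that f)
    have contr: "ell2_norm G (\<lambda>x. S u x - S v x) \<le> q * ell2_norm G (\<lambda>x. u x - v x)"
      if uv: "u \<in> ell2 G" "v \<in> ell2 G" for u v
    proof -
      define d where "d = (\<lambda>x. u x - v x)"
      have d: "d \<in> ell2 G" unfolding d_def by (intro ell2_diff uv)
      have eq: "(\<lambda>x. S u x - S v x) = (\<lambda>x. d x - c * T d x)"
        unfolding d_def S_def bounded_operator_diff[OF T uv] by (simp add: algebra_simps)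
      have re_c: "Re (ell2_inner G d (\<lambda>x. c * T d x)) = \<delta> / K\<^sup>2 * Re (\<omega> * ell2_inner G d (T d))"
        unfolding ell2_inner_scale_right c_def mult.assoc by (simp only: Re_complex_of_real times_complex.sel Im_complex_of_real)
      have norm_c: "ell2_norm G (\<lambda>x. c * T d x) = \<delta> / K\<^sup>2 * ell2_norm G (T d)"
        using \<delta> unfolding ell2_norm_scale c_def by (simp add: norm_mult \<omega> norm_divide norm_power)
      have "(ell2_norm G (\<lambda>x. S u x - S v x))\<^sup>2 =
          (ell2_norm G d)\<^sup>2 - 2 * (\<delta> / K\<^sup>2) * Re (\<omega> * ell2_inner G d (T d)) + (\<delta> / K\<^sup>2)\<^sup>2 * (ell2_norm G (T d))\<^sup>2"
        unfolding eq ell2_norm_diff_power2[OF d ell2_scale[OF T_in[OF d]]] re_c norm_c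
        by (simp only: power_mult_distrib mult.assoc)
      also have "\<dots> \<le> (ell2_norm G d)\<^sup>2 - 2 * (\<delta> / K\<^sup>2) * (\<delta> * (ell2_norm G d)\<^sup>2) + (\<delta> / K\<^sup>2)\<^sup>2 * (K * ell2_norm G d)\<^sup>2"
        using \<delta> by (intro add_mono diff_mono mult_left_mono coercive[OF d] power_mono TK[OF d]) auto
      also have "\<dots> = (q * ell2_norm G d)\<^sup>2"
        using K unfolding power_mult_distrib q2 by (simp add: power2_eq_square field_simps)
      finally have "ell2_norm G (\<lambda>x. S u x - S v x) \<le> q * ell2_norm G d"
        by (rule power2_le_imp_le) (use q in simp)
      then show ?thesis by (simp only: d_def)
    qed
    obtain u where u: "u \<in> ell2 G" "S u = u"
      using ell2_contraction_fixpoint[OF S q contr] by blast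
    have "c \<noteq> 0" using \<delta> K \<omega> by (auto simp: c_def)
    with u(2) have "T u = f" by (simp add: S_def fun_eq_iff)
    with u(1) show ?thesis by blast
  qed
  show bij: "bij_betw T (ell2 G) (ell2 G)"
    using inj surj T_in by (auto simp: bij_betw_def)
  let ?R = "inv_into (ell2 G) T"
  have R: "?R f \<in> ell2 G" "T (?R f) = f" if "f \<in> ell2 G" for f
    using that bij by (auto simp: bij_betw_def inv_into_into f_inv_into_f)
  have R_eq: "?R f = u" if "u \<in> ell2 G" "T u = f" for u f
    using that inj by (auto simp: inv_into_f_f)
  show "bounded_operator G G ?R"
    unfolding bounded_operator_def
  proof (intro conjI ballI allI exI)
    fix f assume f: "f \<in> ell2 G"
    show "?R f \<in> ell2 G" by (rule R[OF f])
    show "ell2_norm G (?R f) \<le> (1 / \<delta>) * ell2_norm G f"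
      using lower[OF R(1)[OF f]] \<delta> by (simp add: R(2)[OF f] field_simps)
    show "?R (\<lambda>v. c * f v) = (\<lambda>w. c * ?R f w)" for c
      using T R[OF f] unfolding bounded_operator_def by (intro R_eq ell2_scale) auto
    show "?R (\<lambda>v. f v + g v) = (\<lambda>w. ?R f w + ?R g w)" if "g \<in> ell2 G" for g
      using T R[OF f] R[OF that] unfolding bounded_operator_def by (intro R_eq ell2_add) auto
  qed
qed

end

section \<open>Laplacians dominated by the masses\<close>

text \<open>Here \<open>s\<close> stands for half the energy and \<open>r\<close> for the squared
  norm. Off the real axis, rotation by \<open>\<i>\<close> or \<open>- \<i>\<close> makes the
  \<open>s\<close> term imaginary and leaves \<open>\<bar>Im z\<bar> * r\<close>; for negative
  \<open>z\<close> the direction 1 works. The constants depend on \<open>z\<close> alone, hence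
  serve all graphs at once.\<close>

lemma obtain_coercivity_direction:
  assumes "z \<notin> complex_of_real ` {0..}"
  obtains \<delta> \<omega> where "\<delta> > 0" "cmod \<omega> = 1"
    "\<And>s r. 0 \<le> s \<Longrightarrow> 0 \<le> r \<Longrightarrow> \<delta> * r \<le> Re (\<omega> * (complex_of_real s - z * complex_of_real r))"
proof -
  consider "Im z > 0" | "Im z < 0" | "Im z = 0" "Re z < 0"
  proof (cases "Im z = 0")
    case True
    then have "z = complex_of_real (Re z)" by (simp add: complex_eq_iff)
    with assms have "Re z < 0" by (metis atLeast_iff image_eqI not_le)
    with True that show ?thesis by blast
  qed (use that in linarith)
  then show ?thesis
  proof cases
    case 1
    then show ?thesis by (intro that[of "Im z" \<i>]) auto
  next
    case 2
    then show ?thesis by (intro that[of "- Im z" "- \<i>"]) auto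
  next
    case 3
    then show ?thesis by (intro that[of "- Re z" 1]) auto
  qed
qed

text \<open>\<open>weight_summable\<close> stands where a weighted graph has local finiteness, which
  reduction can destroy. It also gives \<open>degree_le\<close> its content: a row that is not
  summable would have \<open>degree\<close> equal to 0 by the default of
  \<open>infsum\<close>.\<close>

locale bounded_graph = positive_masses G for G :: "'a wgraph" +
  fixes K :: real
  assumes K_nonneg: "K \<ge> 0"
    and weight_nonneg: "v \<in> verts G \<Longrightarrow> w \<in> verts G \<Longrightarrow> 0 \<le> weight G v w"
    and weight_sym: "v \<in> verts G \<Longrightarrow> w \<in> verts G \<Longrightarrow> weight G v w = weight G w v"
    and weight_summable: "v \<in> verts G \<Longrightarrow> weight G v summable_on verts G"
    and degree_le: "v \<in> verts G \<Longrightarrow> degree G v \<le> K * mass G v"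
begin

text \<open>Summing over \<open>y\<close> first turns the weights into \<open>degree G x\<close>,
  which \<open>degree_le\<close> exchanges for the mass. As all terms are nonnegative, convergence
  of the iterated sum gives convergence of the double sum.\<close>

lemma
  assumes f: "f \<in> ell2 G"
  shows weight_source_summable: "(\<lambda>(x, y). weight G x y * (cmod (f x))\<^sup>2) summable_on verts G \<times> verts G"
    and weight_source_infsum_le: "(\<Sum>\<^sub>\<infinity>(x, y)\<in>verts G \<times> verts G. weight G x y * (cmod (f x))\<^sup>2) \<le> K * (ell2_norm G f)\<^sup>2"
proof -
  have row: "((\<lambda>y. weight G x y * (cmod (f x))\<^sup>2) has_sum degree G x * (cmod (f x))\<^sup>2) (verts G)"
    if "x \<in> verts G" for x
    unfolding degree_def by (intro has_sum_cmult_left has_sum_infsum weight_summable that)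
  have deg: "degree G x * (cmod (f x))\<^sup>2 \<le> K * ((cmod (f x))\<^sup>2 * mass G x)" "0 \<le> degree G x * (cmod (f x))\<^sup>2"
    if "x \<in> verts G" for x
    using mult_right_mono[OF degree_le[OF that], of "(cmod (f x))\<^sup>2"] that
    by (auto simp: mult_ac degree_def intro!: mult_nonneg_nonneg infsum_nonneg weight_nonneg)
  have Ks: "(\<lambda>x. K * ((cmod (f x))\<^sup>2 * mass G x)) summable_on verts G"
    by (intro summable_on_cmult_right ell2_summable f)
  have col: "(\<lambda>x. degree G x * (cmod (f x))\<^sup>2) summable_on verts G"
    by (rule summable_on_comparison_test[OF Ks deg])
  show s: "(\<lambda>(x, y). weight G x y * (cmod (f x))\<^sup>2) summable_on verts G \<times> verts G"
    by (rule summable_on_SigmaI[OF _ col]) (auto intro!: row weight_nonneg mult_nonneg_nonneg)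
  have "((\<lambda>(x, y). weight G x y * (cmod (f x))\<^sup>2) has_sum
      (\<Sum>\<^sub>\<infinity>x\<in>verts G. degree G x * (cmod (f x))\<^sup>2)) (verts G \<times> verts G)"
    by (rule has_sum_SigmaI[OF _ has_sum_infsum[OF col] s]) (auto intro: row)
  then have "(\<Sum>\<^sub>\<infinity>(x, y)\<in>verts G \<times> verts G. weight G x y * (cmod (f x))\<^sup>2)
      = (\<Sum>\<^sub>\<infinity>x\<in>verts G. degree G x * (cmod (f x))\<^sup>2)"
    by (rule infsumI)
  also have "\<dots> \<le> (\<Sum>\<^sub>\<infinity>x\<in>verts G. K * ((cmod (f x))\<^sup>2 * mass G x))"
    by (rule infsum_mono[OF col Ks deg(1)])
  also have "\<dots> = K * (ell2_norm G f)\<^sup>2"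
    by (simp add: ell2_norm_power2 infsum_cmult_right')
  finally show "(\<Sum>\<^sub>\<infinity>(x, y)\<in>verts G \<times> verts G. weight G x y * (cmod (f x))\<^sup>2) \<le> K * (ell2_norm G f)\<^sup>2" .
qed

text \<open>By symmetry of the weights, exchanging the two coordinates reduces this to the sum with
  \<open>f\<close> evaluated at the source.\<close>

lemma
  assumes f: "f \<in> ell2 G"
  shows weight_target_summable: "(\<lambda>(x, y). weight G x y * (cmod (f y))\<^sup>2) summable_on verts G \<times> verts G"
    and weight_target_infsum_le: "(\<Sum>\<^sub>\<infinity>(x, y)\<in>verts G \<times> verts G. weight G x y * (cmod (f y))\<^sup>2) \<le> K * (ell2_norm G f)\<^sup>2"
proof -
  have bij: "bij_betw prod.swap (verts G \<times> verts G) (verts G \<times> verts G)"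
    by (auto simp: bij_betw_def inj_on_def)
  have eq: "(\<lambda>(x, y). weight G x y * (cmod (f x))\<^sup>2) (prod.swap p) = (\<lambda>(x, y). weight G x y * (cmod (f y))\<^sup>2) p"
    if "p \<in> verts G \<times> verts G" for p
    using that weight_sym by auto
  show "(\<lambda>(x, y). weight G x y * (cmod (f y))\<^sup>2) summable_on verts G \<times> verts G"
    using weight_source_summable[OF f] summable_on_reindex_bij_betw[OF bij] eq
    by (smt (verit) summable_on_cong)
  show "(\<Sum>\<^sub>\<infinity>(x, y)\<in>verts G \<times> verts G. weight G x y * (cmod (f y))\<^sup>2) \<le> K * (ell2_norm G f)\<^sup>2"
    using weight_source_infsum_le[OF f] infsum_reindex_bij_betw[OF bij] eq
    by (smt (verit) infsum_cong)
qed

text \<open>The Dirichlet energy over ordered pairs: an edge between distinct vertices counts once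
  in each direction, which accounts for the factor 1/2 in
  \<open>ell2_inner_laplacian\<close>.\<close>

definition energy :: "('a \<Rightarrow> complex) \<Rightarrow> real" where
  "energy f = (\<Sum>\<^sub>\<infinity>(x, y)\<in>verts G \<times> verts G. weight G x y * (cmod (f x - f y))\<^sup>2)"

lemma
  assumes f: "f \<in> ell2 G"
  shows energy_summable: "(\<lambda>(x, y). weight G x y * (cmod (f x - f y))\<^sup>2) summable_on verts G \<times> verts G"
    and energy_le: "energy f \<le> 4 * K * (ell2_norm G f)\<^sup>2"
proof -
  let ?s = "\<lambda>(x, y). weight G x y * (cmod (f x))\<^sup>2" and ?t = "\<lambda>(x, y). weight G x y * (cmod (f y))\<^sup>2"
  have sum: "(\<lambda>p. 2 * ?s p + 2 * ?t p) summable_on verts G \<times> verts G"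
    by (intro summable_on_add summable_on_cmult_right weight_source_summable weight_target_summable f)
  have le: "(\<lambda>(x, y). weight G x y * (cmod (f x - f y))\<^sup>2) p \<le> 2 * ?s p + 2 * ?t p"
    "0 \<le> (\<lambda>(x, y). weight G x y * (cmod (f x - f y))\<^sup>2) p" if "p \<in> verts G \<times> verts G" for p
    using that mult_left_mono[OF cmod_diff_power2_le[of "f (fst p)" "f (snd p)"] weight_nonneg, of "fst p" "snd p"]
    by (auto simp: algebra_simps weight_nonneg)
  show s: "(\<lambda>(x, y). weight G x y * (cmod (f x - f y))\<^sup>2) summable_on verts G \<times> verts G"
    by (rule summable_on_comparison_test[OF sum le])
  have "energy f \<le> (\<Sum>\<^sub>\<infinity>p\<in>verts G \<times> verts G. 2 * ?s p + 2 * ?t p)"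
    unfolding energy_def by (rule infsum_mono[OF s sum le(1)])
  also have "\<dots> = 2 * infsum ?s (verts G \<times> verts G) + 2 * infsum ?t (verts G \<times> verts G)"
    by (subst infsum_add) (auto simp: infsum_cmult_right' intro!: summable_on_cmult_right
        weight_source_summable weight_target_summable f)
  finally show "energy f \<le> 4 * K * (ell2_norm G f)\<^sup>2"
    using weight_source_infsum_le[OF f] weight_target_infsum_le[OF f] by simp
qed

lemma energy_nonneg [simp]: "0 \<le> energy f"
  unfolding energy_def by (auto intro!: infsum_nonneg weight_nonneg mult_nonneg_nonneg)

text \<open>One term of a sum of nonnegative terms. Through this estimate a bounded energy and a
  large weight force the values at the two ends together.\<close>

lemma edge_le_energy:
  assumes "f \<in> ell2 G" "x \<in> verts G" "y \<in> verts G"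
  shows "weight G x y * (cmod (f x - f y))\<^sup>2 \<le> energy f"
  using finite_sum_le_infsum[OF energy_summable[OF assms(1)], of "{(x, y)}"] assms
  by (auto simp: energy_def weight_nonneg)

text \<open>Cauchy-Schwarz along a row, with the weight split into two square roots: one factor
  becomes the degree and is bounded by the mass, the other is the energy of the row.\<close>

lemma
  assumes f: "f \<in> ell2 G" and x: "x \<in> verts G"
  shows weighted_differences_summable: "(\<lambda>y. weight G x y * cmod (f x - f y)) summable_on verts G"
    and weighted_differences_le:
      "(\<Sum>\<^sub>\<infinity>y\<in>verts G. weight G x y * cmod (f x - f y))\<^sup>2
        \<le> K * mass G x * (\<Sum>\<^sub>\<infinity>y\<in>verts G. weight G x y * (cmod (f x - f y))\<^sup>2)"
proof -
  have row: "(\<lambda>y. weight G x y * (cmod (f x - f y))\<^sup>2) summable_on verts G"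
    using summable_on_SigmaD1[OF energy_summable[OF f] x] weight_nonneg[OF x] by auto
  have 1: "(sqrt (weight G x y))\<^sup>2 = weight G x y"
    "(sqrt (weight G x y) * cmod (f x - f y))\<^sup>2 = weight G x y * (cmod (f x - f y))\<^sup>2"
    "\<bar>sqrt (weight G x y)\<bar> * \<bar>sqrt (weight G x y) * cmod (f x - f y)\<bar> = weight G x y * cmod (f x - f y)"
    if "y \<in> verts G" for y
    using weight_nonneg[OF x that] by (auto simp: power_mult_distrib abs_mult)
  have sq: "(\<lambda>y. (sqrt (weight G x y))\<^sup>2) summable_on verts G"
    "(\<lambda>y. (sqrt (weight G x y) * cmod (f x - f y))\<^sup>2) summable_on verts G"
    using weight_summable[OF x] row 1 by (simp_all cong: summable_on_cong)
  note cs = cauchy_schwarz_infsum[OF sq]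
  show "(\<lambda>y. weight G x y * cmod (f x - f y)) summable_on verts G"
    using cs(1) 1 by (simp cong: summable_on_cong)
  let ?E = "\<Sum>\<^sub>\<infinity>y\<in>verts G. weight G x y * (cmod (f x - f y))\<^sup>2"
  have E: "?E \<ge> 0" by (auto intro!: infsum_nonneg weight_nonneg mult_nonneg_nonneg x)
  have d: "degree G x \<ge> 0" unfolding degree_def by (auto intro!: infsum_nonneg weight_nonneg x)
  have "(\<Sum>\<^sub>\<infinity>y\<in>verts G. weight G x y * cmod (f x - f y)) \<le> sqrt (degree G x) * sqrt ?E"
    using cs(2) 1 by (simp add: degree_def cong: infsum_cong)
  then have "(\<Sum>\<^sub>\<infinity>y\<in>verts G. weight G x y * cmod (f x - f y))\<^sup>2 \<le> (sqrt (degree G x) * sqrt ?E)\<^sup>2"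
    by (intro power_mono) (auto intro!: infsum_nonneg weight_nonneg mult_nonneg_nonneg x)
  also have "\<dots> = degree G x * ?E" using d E by (simp add: power_mult_distrib)
  also have "\<dots> \<le> K * mass G x * ?E" by (intro mult_right_mono degree_le x E)
  finally show "(\<Sum>\<^sub>\<infinity>y\<in>verts G. weight G x y * cmod (f x - f y))\<^sup>2 \<le> K * mass G x * ?E" .
qed

text \<open>The difference form of the Laplacian: weights and weighted differences are both summable
  along the row, so the sum in the definition of \<open>laplacian\<close> can be split. The norm
  bound is the row estimate with one factor \<open>mass G x\<close> cancelled.\<close>

lemma
  assumes f: "f \<in> ell2 G" and x: "x \<in> verts G"
  shows laplacian_summable: "(\<lambda>y. complex_of_real (weight G x y) * (f x - f y)) summable_on verts G"
    and laplacian_mass: "laplacian G f x * complex_of_real (mass G x)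
      = (\<Sum>\<^sub>\<infinity>y\<in>verts G. complex_of_real (weight G x y) * (f x - f y))"
    and cmod_laplacian_le: "(cmod (laplacian G f x))\<^sup>2 * mass G x
      \<le> K * (\<Sum>\<^sub>\<infinity>y\<in>verts G. weight G x y * (cmod (f x - f y))\<^sup>2)"
proof -
  have le: "cmod (complex_of_real (weight G x y) * (f x - f y)) \<le> weight G x y * cmod (f x - f y)"
    if "y \<in> verts G" for y
    using weight_nonneg[OF x that] by (simp add: norm_mult)
  note s = cmod_infsum_le_infsum[OF weighted_differences_summable[OF f x] le]
  show s1: "(\<lambda>y. complex_of_real (weight G x y) * (f x - f y)) summable_on verts G" by (rule s(1))
  have d: "((\<lambda>y. complex_of_real (weight G x y)) has_sum complex_of_real (degree G x)) (verts G)"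
    unfolding degree_def by (intro has_sum_of_real has_sum_infsum weight_summable x)
  have "((\<lambda>y. complex_of_real (weight G x y) * f x + - (complex_of_real (weight G x y) * (f x - f y))) has_sum
      complex_of_real (degree G x) * f x + - (\<Sum>\<^sub>\<infinity>y\<in>verts G. complex_of_real (weight G x y) * (f x - f y))) (verts G)"
    by (intro has_sum_add has_sum_uminusI has_sum_cmult_left d has_sum_infsum s1)
  then have "(\<Sum>\<^sub>\<infinity>y\<in>verts G. complex_of_real (weight G x y) * f y) =
      complex_of_real (degree G x) * f x - (\<Sum>\<^sub>\<infinity>y\<in>verts G. complex_of_real (weight G x y) * (f x - f y))"
    by (intro infsumI) (simp add: algebra_simps)
  then show lm: "laplacian G f x * complex_of_real (mass G x)
      = (\<Sum>\<^sub>\<infinity>y\<in>verts G. complex_of_real (weight G x y) * (f x - f y))"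
    using x mass_pos[OF x] by (simp add: laplacian_def)
  have m: "mass G x > 0" by (rule mass_pos[OF x])
  have "cmod (laplacian G f x) * mass G x = cmod (laplacian G f x * complex_of_real (mass G x))"
    using m by (simp add: norm_mult)
  also have "\<dots> \<le> (\<Sum>\<^sub>\<infinity>y\<in>verts G. weight G x y * cmod (f x - f y))"
    unfolding lm by (rule s(2))
  finally have "(cmod (laplacian G f x) * mass G x)\<^sup>2 \<le> (\<Sum>\<^sub>\<infinity>y\<in>verts G. weight G x y * cmod (f x - f y))\<^sup>2"
    using m by (intro power_mono) auto
  also have "\<dots> \<le> K * mass G x * (\<Sum>\<^sub>\<infinity>y\<in>verts G. weight G x y * (cmod (f x - f y))\<^sup>2)"
    by (rule weighted_differences_le[OF f x])
  finally have "mass G x * ((cmod (laplacian G f x))\<^sup>2 * mass G x)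
      \<le> mass G x * (K * (\<Sum>\<^sub>\<infinity>y\<in>verts G. weight G x y * (cmod (f x - f y))\<^sup>2))"
    by (simp add: power2_eq_square mult_ac)
  then show "(cmod (laplacian G f x))\<^sup>2 * mass G x
      \<le> K * (\<Sum>\<^sub>\<infinity>y\<in>verts G. weight G x y * (cmod (f x - f y))\<^sup>2)"
    using m by (simp only: mult_le_cancel_left_pos)
qed

lemma
  assumes f: "f \<in> ell2 G"
  shows laplacian_in_ell2: "laplacian G f \<in> ell2 G"
    and ell2_norm_laplacian_le: "ell2_norm G (laplacian G f) \<le> 2 * K * ell2_norm G f"
proof -
  let ?E = "\<lambda>x. \<Sum>\<^sub>\<infinity>y\<in>verts G. weight G x y * (cmod (f x - f y))\<^sup>2"
  have E: "(\<lambda>x. K * ?E x) summable_on verts G"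
    using summable_on_Sigma_banach[OF energy_summable[OF f]] by (intro summable_on_cmult_right) simp
  show L: "laplacian G f \<in> ell2 G"
    unfolding ell2_def using summable_on_comparison_test[OF E cmod_laplacian_le[OF f]]
    by (auto simp: laplacian_def[of _ _ v for v])
  have "(ell2_norm G (laplacian G f))\<^sup>2 \<le> (\<Sum>\<^sub>\<infinity>x\<in>verts G. K * ?E x)"
    unfolding ell2_norm_power2 by (rule infsum_mono[OF ell2_summable[OF L] E cmod_laplacian_le[OF f]])
  also have "\<dots> = K * energy f"
    unfolding energy_def using infsum_Sigma_banach[OF energy_summable[OF f]] by (simp add: infsum_cmult_right')
  also have "\<dots> \<le> K * (4 * K * (ell2_norm G f)\<^sup>2)" by (intro mult_left_mono energy_le f K_nonneg)
  also have "\<dots> = (2 * K * ell2_norm G f)\<^sup>2" by (simp add: power2_eq_square)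
  finally show "ell2_norm G (laplacian G f) \<le> 2 * K * ell2_norm G f"
    by (rule power2_le_imp_le) (simp add: K_nonneg)
qed

lemma laplacian_add:
  assumes "f \<in> ell2 G" "g \<in> ell2 G"
  shows "laplacian G (\<lambda>v. f v + g v) = (\<lambda>v. laplacian G f v + laplacian G g v)"
proof
  fix x
  show "laplacian G (\<lambda>v. f v + g v) x = laplacian G f x + laplacian G g x"
  proof (cases "x \<in> verts G")
    case True
    have "laplacian G (\<lambda>v. f v + g v) x * complex_of_real (mass G x) =
      (laplacian G f x + laplacian G g x) * complex_of_real (mass G x)"
      unfolding distrib_right laplacian_mass[OF ell2_add[OF assms] True] laplacian_mass[OF assms(1) True]
        laplacian_mass[OF assms(2) True]
      using infsum_add[OF laplacian_summable[OF assms(1) True] laplacian_summable[OF assms(2) True]]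
      by (simp add: algebra_simps)
    then show ?thesis using mass_pos[OF True] by simp
  qed (simp add: laplacian_def)
qed

lemma laplacian_scale: "laplacian G (\<lambda>v. c * f v) = (\<lambda>v. c * laplacian G f v)"
proof
  fix x
  have "(\<Sum>\<^sub>\<infinity>y\<in>verts G. complex_of_real (weight G x y) * (c * f y))
      = c * (\<Sum>\<^sub>\<infinity>y\<in>verts G. complex_of_real (weight G x y) * f y)"
    unfolding infsum_cmult_right'[symmetric] by (simp add: mult.left_commute)
  then show "laplacian G (\<lambda>v. c * f v) x = c * laplacian G f x"
    by (simp add: laplacian_def algebra_simps)
qed

text \<open>Green's formula. The inner product is a double sum of \<open>F\<close>; averaging
  \<open>F\<close> with its image under exchange of coordinates replaces
  \<open>cnj (u x) * (u x - u y)\<close> by half the squared modulus of the difference.\<close>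

lemma ell2_inner_laplacian:
  assumes u: "u \<in> ell2 G"
  shows "ell2_inner G u (laplacian G u) = complex_of_real (energy u / 2)"
proof -
  define F where "F = (\<lambda>(x, y). complex_of_real (weight G x y) * (cnj (u x) * (u x - u y)))"
  let ?V = "verts G \<times> verts G"
  \<comment> \<open>A product is dominated by the sum of the squares, so \<open>F\<close> is
    absolutely summable over pairs, as passing from the iterated to the double sum requires.\<close>
  have le: "cmod (F p) \<le> (\<lambda>(x, y). weight G x y * (cmod (u x))\<^sup>2) p + (\<lambda>(x, y). weight G x y * (cmod (u x - u y))\<^sup>2) p"
    if p_in: "p \<in> ?V" for p
  proof -
    obtain x y where p: "p = (x, y)" "x \<in> verts G" "y \<in> verts G" using p_in by auto
    have "cmod (u x) * cmod (u x - u y) \<le> (cmod (u x))\<^sup>2 + (cmod (u x - u y))\<^sup>2"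
      using sum_squares_bound[of "cmod (u x)" "cmod (u x - u y)"]
        mult_nonneg_nonneg[of "cmod (u x)" "cmod (u x - u y)"] norm_ge_zero[of "u x"]
        norm_ge_zero[of "u x - u y"] unfolding mult.assoc by linarith
    from mult_left_mono[OF this weight_nonneg[OF p(2,3)]] show ?thesis
      using weight_nonneg[OF p(2,3)] by (simp add: F_def p norm_mult distrib_left)
  qed
  have F: "F summable_on ?V"
    by (rule cmod_infsum_le_infsum(1)[OF _ le])
      (intro summable_on_add weight_source_summable energy_summable u)
  have "ell2_inner G u (laplacian G u) = (\<Sum>\<^sub>\<infinity>x\<in>verts G. \<Sum>\<^sub>\<infinity>y\<in>verts G. F (x, y))"
    unfolding ell2_inner_def
  proof (rule infsum_cong)
    fix x assume x: "x \<in> verts G"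
    have "cnj (u x) * laplacian G u x * complex_of_real (mass G x) =
      cnj (u x) * (\<Sum>\<^sub>\<infinity>y\<in>verts G. complex_of_real (weight G x y) * (u x - u y))"
      using laplacian_mass[OF u x] by (simp add: mult.assoc)
    then show "cnj (u x) * laplacian G u x * complex_of_real (mass G x) = (\<Sum>\<^sub>\<infinity>y\<in>verts G. F (x, y))"
      unfolding infsum_cmult_right'[symmetric] by (simp add: F_def mult_ac)
  qed
  also have "\<dots> = infsum F ?V" by (rule infsum_Sigma_banach[OF F])
  finally have inner: "ell2_inner G u (laplacian G u) = infsum F ?V" .
  have bij: "bij_betw prod.swap ?V ?V" by (auto simp: bij_betw_def inj_on_def)
  have F': "(\<lambda>p. F (prod.swap p)) summable_on ?V" "infsum (\<lambda>p. F (prod.swap p)) ?V = infsum F ?V"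
    using F summable_on_reindex_bij_betw[OF bij] infsum_reindex_bij_betw[OF bij] by auto
  have "2 * infsum F ?V = (\<Sum>\<^sub>\<infinity>p\<in>?V. F p + F (prod.swap p))"
    using infsum_add[OF F F'(1)] F'(2) by simp
  also have "\<dots> = (\<Sum>\<^sub>\<infinity>p\<in>?V. complex_of_real ((\<lambda>(x, y). weight G x y * (cmod (u x - u y))\<^sup>2) p))"
  proof (rule infsum_cong)
    fix p assume "p \<in> ?V"
    then obtain x y where p: "p = (x, y)" "x \<in> verts G" "y \<in> verts G" by auto
    have "F p + F (prod.swap p) = complex_of_real (weight G x y) * ((u x - u y) * cnj (u x - u y))"
      using weight_sym[OF p(2,3)] by (simp add: F_def p algebra_simps)
    then show "F p + F (prod.swap p) = complex_of_real ((\<lambda>(x, y). weight G x y * (cmod (u x - u y))\<^sup>2) p)"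
      by (simp only: p prod.case of_real_mult complex_norm_square)
  qed
  also have "\<dots> = complex_of_real (energy u)"
    unfolding energy_def by (intro infsumI has_sum_of_real has_sum_infsum energy_summable u)
  finally show ?thesis unfolding inner by (simp add: field_simps)
qed

lemma bounded_operator_shift_laplacian: "bounded_operator G G (shift_op (laplacian G) z)"
  unfolding bounded_operator_def
proof (intro conjI ballI allI exI)
  fix f assume f: "f \<in> ell2 G"
  show "shift_op (laplacian G) z f \<in> ell2 G"
    unfolding shift_op_def by (intro ell2_diff ell2_scale laplacian_in_ell2 f)
  show "ell2_norm G (shift_op (laplacian G) z f) \<le> (2 * K + cmod z) * ell2_norm G f"
    using ell2_norm_diff_triangle[OF laplacian_in_ell2[OF f] ell2_scale[OF f, of z]]
      ell2_norm_laplacian_le[OF f]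
    by (simp add: shift_op_def ell2_norm_scale algebra_simps)
  show "shift_op (laplacian G) z (\<lambda>v. c * f v) = (\<lambda>w. c * shift_op (laplacian G) z f w)" for c
    by (simp add: shift_op_def laplacian_scale algebra_simps)
  show "shift_op (laplacian G) z (\<lambda>v. f v + g v) = (\<lambda>w. shift_op (laplacian G) z f w + shift_op (laplacian G) z g w)"
    if "g \<in> ell2 G" for g
    by (simp add: shift_op_def laplacian_add[OF f that] algebra_simps)
qed

lemma ell2_inner_shift_laplacian:
  assumes "u \<in> ell2 G"
  shows "ell2_inner G u (shift_op (laplacian G) z u)
    = complex_of_real (energy u / 2) - z * complex_of_real ((ell2_norm G u)\<^sup>2)"
  unfolding shift_op_def
  by (simp add: ell2_inner_diff_right[OF assms laplacian_in_ell2 ell2_scale] assms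
      ell2_inner_laplacian ell2_inner_scale_right ell2_inner_self)

section \<open>Resolvents off the nonnegative half-line, with constants independent of the
  graph\<close>

context
  fixes z \<omega> :: complex and \<delta> :: real
  assumes \<delta>: "\<delta> > 0" and \<omega>: "cmod \<omega> = 1"
    and direction: "\<And>s r. 0 \<le> s \<Longrightarrow> 0 \<le> r \<Longrightarrow>
      \<delta> * r \<le> Re (\<omega> * (complex_of_real s - z * complex_of_real r))"
begin

lemma shift_laplacian_coercive:
  assumes "u \<in> ell2 G"
  shows "\<delta> * (ell2_norm G u)\<^sup>2 \<le> Re (\<omega> * ell2_inner G u (shift_op (laplacian G) z u))"
  unfolding ell2_inner_shift_laplacian[OF assms] by (rule direction) auto

lemma in_resolvent_set: "z \<in> resolvent_set G (laplacian G)"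
  unfolding resolvent_set_def resolvent_def
  using coercive_bij_betw[OF bounded_operator_shift_laplacian \<delta> \<omega> shift_laplacian_coercive]
    coercive_inverse_bounded[OF bounded_operator_shift_laplacian \<delta> \<omega> shift_laplacian_coercive]
  by auto

lemma shift_laplacian_lower_bound:
  "u \<in> ell2 G \<Longrightarrow> \<delta> * ell2_norm G u \<le> ell2_norm G (shift_op (laplacian G) z u)"
  by (rule coercive_lower_bound[OF bounded_operator_shift_laplacian \<delta> \<omega> shift_laplacian_coercive])

end

end

lemma
  assumes "z \<in> resolvent_set G T"
  shows resolvent_in_ell2: "f \<in> ell2 G \<Longrightarrow> resolvent G T z f \<in> ell2 G"
    and shift_op_resolvent: "f \<in> ell2 G \<Longrightarrow> shift_op T z (resolvent G T z f) = f"
    and resolvent_eqI: "u \<in> ell2 G \<Longrightarrow> shift_op T z u = f \<Longrightarrow> resolvent G T z f = u"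
  using assms unfolding resolvent_set_def resolvent_def
  by (auto simp: bij_betw_def inv_into_into f_inv_into_f inv_into_f_f)

section \<open>The reduced graph\<close>

text \<open>Reindexing by \<open>\<lambda>a. (p a, a)\<close> presents \<open>A\<close> as a
  dependent sum of the fibres, to which Fubini for infinite sums applies.\<close>

lemma
  fixes f :: "'b \<Rightarrow> 'c::banach"
  assumes f: "f summable_on A" and p: "p ` A \<subseteq> Q"
  shows summable_on_fibres: "(\<lambda>q. infsum f {a \<in> A. p a = q}) summable_on Q"
    and infsum_fibres: "(\<Sum>\<^sub>\<infinity>q\<in>Q. infsum f {a \<in> A. p a = q}) = infsum f A"
proof -
  have bij: "bij_betw (\<lambda>a. (p a, a)) A (Sigma Q (\<lambda>q. {a \<in> A. p a = q}))"
    using p by (auto simp: bij_betw_def inj_on_def)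
  have s: "(\<lambda>(q, a). f a) summable_on Sigma Q (\<lambda>q. {a \<in> A. p a = q})"
    using summable_on_reindex_bij_betw[OF bij, of "\<lambda>(q, a). f a"] f by simp
  show "(\<lambda>q. infsum f {a \<in> A. p a = q}) summable_on Q"
    using summable_on_Sigma_banach[OF s] by simp
  show "(\<Sum>\<^sub>\<infinity>q\<in>Q. infsum f {a \<in> A. p a = q}) = infsum f A"
    using infsum_Sigma_banach[OF s] infsum_reindex_bij_betw[OF bij, of "\<lambda>(q, a). f a"] by simp
qed

lemma
  fixes f :: "'b \<Rightarrow> real"
  assumes nonneg: "\<And>a. a \<in> A \<Longrightarrow> 0 \<le> f a" and p: "p ` A \<subseteq> Q"
    and f: "\<And>q. q \<in> Q \<Longrightarrow> (f has_sum g q) {a \<in> A. p a = q}" and g: "g summable_on Q"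
  shows summable_on_if_fibres: "f summable_on A"
    and infsum_if_fibres: "infsum f A = infsum g Q"
proof -
  have bij: "bij_betw (\<lambda>a. (p a, a)) A (Sigma Q (\<lambda>q. {a \<in> A. p a = q}))"
    using p by (auto simp: bij_betw_def inj_on_def)
  have "(\<lambda>(q, a). f a) summable_on Sigma Q (\<lambda>q. {a \<in> A. p a = q})"
    by (rule summable_on_SigmaI[OF _ g]) (use f nonneg in auto)
  then show s: "f summable_on A"
    using summable_on_reindex_bij_betw[OF bij, of "\<lambda>(q, a). f a"] by simp
  have "(\<Sum>\<^sub>\<infinity>q\<in>Q. infsum f {a \<in> A. p a = q}) = infsum g Q"
    by (intro infsum_cong infsumI f)
  then show "infsum f A = infsum g Q" using infsum_fibres[OF s p] by simp
qed

text \<open>Finite mass of the components of \<open>F\<close> puts their indicators into the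
  sequence space and makes the reduced masses positive: a divergent sum would have the value
  0.\<close>

locale clustered_graph = bounded_graph +
  fixes F :: "('a \<times> 'a) set"
  assumes F_subset: "F \<subseteq> verts G \<times> verts G" and F_sym: "sym F"
    and cluster_mass_summable: "x \<in> verts G \<Longrightarrow> mass G summable_on F\<^sup>* `` {x}"
begin

section \<open>Vertices and weights of the reduced graph\<close>

abbreviation cluster :: "'a \<Rightarrow> 'a set" where
  "cluster x \<equiv> F\<^sup>* `` {x}"

abbreviation reduced :: "'a set wgraph" where
  "reduced \<equiv> reduced_graph G F"

lemma verts_reduced: "verts reduced = verts G // F\<^sup>*"
  and mass_reduced: "mass reduced C = (\<Sum>\<^sub>\<infinity>v\<in>C. mass G v)"
  and weight_reduced: "weight reduced C D = (\<Sum>\<^sub>\<infinity>(v, w)\<in>C \<times> D. weight G v w)"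
  by (simp_all add: reduced_graph_def)

lemma equiv_clusters: "equiv UNIV (F\<^sup>*)"
  by (intro equivI refl_rtrancl sym_rtrancl trans_rtrancl F_sym) auto

lemma cluster_eq_iff: "cluster x = cluster y \<longleftrightarrow> (x, y) \<in> F\<^sup>*"
  using eq_equiv_class_iff[OF equiv_clusters] by simp

lemma cluster_in_reduced [simp]: "x \<in> verts G \<Longrightarrow> cluster x \<in> verts reduced"
  by (simp add: verts_reduced quotientI)

lemma cluster_subset: "x \<in> verts G \<Longrightarrow> cluster x \<subseteq> verts G"
proof
  fix y assume "x \<in> verts G" "y \<in> cluster x"
  then have "(x, y) \<in> F\<^sup>*" by simp
  then show "y \<in> verts G"
    using \<open>x \<in> verts G\<close> F_subset by (induction rule: rtrancl_induct) auto
qed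

lemma
  assumes "C \<in> verts reduced"
  shows reduced_vertex_subset: "C \<subseteq> verts G" and reduced_vertex_nonempty: "C \<noteq> {}"
    and cluster_of_member: "x \<in> C \<Longrightarrow> cluster x = C"
    and mass_summable_reduced_vertex: "mass G summable_on C"
proof -
  obtain y where y: "y \<in> verts G" "C = cluster y"
    using assms by (auto simp: verts_reduced elim: quotientE)
  show "C \<subseteq> verts G" "C \<noteq> {}" "mass G summable_on C"
    using cluster_subset[OF y(1)] cluster_mass_summable[OF y(1)] y by auto
  show "cluster x = C" if "x \<in> C"
    using that y cluster_eq_iff[of y x] by simp
qed

lemma cluster_fibre: "C \<in> verts reduced \<Longrightarrow> {x \<in> verts G. cluster x = C} = C"
  using reduced_vertex_subset cluster_of_member by blast

lemma
  fixes f :: "'a \<Rightarrow> 'c::banach"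
  assumes f: "f summable_on verts G"
  shows summable_on_clusters: "(\<lambda>C. infsum f C) summable_on verts reduced"
    and infsum_clusters: "(\<Sum>\<^sub>\<infinity>C\<in>verts reduced. infsum f C) = infsum f (verts G)"
proof -
  have cl: "cluster ` verts G \<subseteq> verts reduced" by auto
  have eq: "infsum f C = infsum f {x \<in> verts G. cluster x = C}" if "C \<in> verts reduced" for C
    by (simp only: cluster_fibre[OF that])
  show "(\<lambda>C. infsum f C) summable_on verts reduced"
    using summable_on_fibres[OF f cl] by (subst summable_on_cong[OF eq])
  show "(\<Sum>\<^sub>\<infinity>C\<in>verts reduced. infsum f C) = infsum f (verts G)"
    using infsum_fibres[OF f cl] by (subst infsum_cong[OF eq])
qed

text \<open>The projection is \<open>cluster\<close> of the second coordinate, and its fibres are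
  the blocks \<open>C \<times> D\<close>.\<close>

lemma
  fixes f :: "'a \<times> 'a \<Rightarrow> 'c::banach"
  assumes f: "f summable_on C \<times> verts G"
  shows summable_on_cluster_columns: "(\<lambda>D. infsum f (C \<times> D)) summable_on verts reduced"
    and infsum_cluster_columns: "(\<Sum>\<^sub>\<infinity>D\<in>verts reduced. infsum f (C \<times> D)) = infsum f (C \<times> verts G)"
proof -
  have eq: "infsum f (C \<times> D) = infsum f {p \<in> C \<times> verts G. cluster (snd p) = D}"
    if "D \<in> verts reduced" for D
  proof -
    have "{p \<in> C \<times> verts G. cluster (snd p) = D} = C \<times> {x \<in> verts G. cluster x = D}" by auto
    then show ?thesis by (simp only: cluster_fibre[OF that])
  qed
  have cl: "(\<lambda>p. cluster (snd p)) ` (C \<times> verts G) \<subseteq> verts reduced" by auto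
  show "(\<lambda>D. infsum f (C \<times> D)) summable_on verts reduced"
    using summable_on_fibres[OF f cl] by (subst summable_on_cong[OF eq])
  show "(\<Sum>\<^sub>\<infinity>D\<in>verts reduced. infsum f (C \<times> D)) = infsum f (C \<times> verts G)"
    using infsum_fibres[OF f cl] by (subst infsum_cong[OF eq])
qed

lemma
  assumes C: "C \<in> verts reduced"
  shows weight_summable_strip: "(\<lambda>(x, y). weight G x y) summable_on C \<times> verts G"
    and weight_infsum_strip_le: "(\<Sum>\<^sub>\<infinity>(x, y)\<in>C \<times> verts G. weight G x y) \<le> K * mass reduced C"
proof -
  note sub = reduced_vertex_subset[OF C]
  have row: "((\<lambda>y. weight G x y) has_sum degree G x) (verts G)" if "x \<in> C" for x
    unfolding degree_def using that sub by (intro has_sum_infsum weight_summable) auto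
  have Km: "(\<lambda>x. K * mass G x) summable_on C"
    by (intro summable_on_cmult_right mass_summable_reduced_vertex C)
  have deg: "degree G x \<le> K * mass G x" "0 \<le> degree G x" if "x \<in> C" for x
  proof -
    have x: "x \<in> verts G" using that sub by auto
    show "degree G x \<le> K * mass G x" by (rule degree_le[OF x])
    show "0 \<le> degree G x" unfolding degree_def by (intro infsum_nonneg weight_nonneg x)
  qed
  have d: "degree G summable_on C" by (rule summable_on_comparison_test[OF Km deg])
  show s: "(\<lambda>(x, y). weight G x y) summable_on C \<times> verts G"
    by (rule summable_on_SigmaI[OF _ d]) (use row sub weight_nonneg in auto)
  have "(\<Sum>\<^sub>\<infinity>(x, y)\<in>C \<times> verts G. weight G x y) = infsum (degree G) C"
    by (intro infsumI has_sum_SigmaI[OF _ has_sum_infsum[OF d] s]) (use row in auto)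
  also have "\<dots> \<le> (\<Sum>\<^sub>\<infinity>x\<in>C. K * mass G x)" by (rule infsum_mono[OF d Km deg(1)])
  also have "\<dots> = K * mass reduced C" by (simp add: mass_reduced infsum_cmult_right')
  finally show "(\<Sum>\<^sub>\<infinity>(x, y)\<in>C \<times> verts G. weight G x y) \<le> K * mass reduced C" .
qed

text \<open>The degree of \<open>C\<close> in the reduced graph is the sum of the weights over the
  strip \<open>C \<times> verts G\<close>, so the constant \<open>K\<close> of \<open>G\<close>
  carries over. Positivity of the mass comes from any one member of the cluster.\<close>

lemma bounded_graph_reduced: "bounded_graph reduced K"
proof
  fix C assume C: "C \<in> verts reduced"
  note sub = reduced_vertex_subset[OF C]
  obtain x where x: "x \<in> C" using reduced_vertex_nonempty[OF C] by auto
  have "sum (mass G) {x} \<le> mass reduced C"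
    unfolding mass_reduced
    by (rule finite_sum_le_infsum[OF mass_summable_reduced_vertex[OF C]]) (use x sub in auto)
  then show "mass reduced C > 0" using mass_pos[of x] x sub by auto
  show "weight reduced C summable_on verts reduced"
    using summable_on_cluster_columns[OF weight_summable_strip[OF C]] by (simp add: weight_reduced[abs_def])
  show "degree reduced C \<le> K * mass reduced C"
    using infsum_cluster_columns[OF weight_summable_strip[OF C]] weight_infsum_strip_le[OF C]
    by (simp add: degree_def weight_reduced)
  fix D assume D: "D \<in> verts reduced"
  note sub' = reduced_vertex_subset[OF D]
  show "0 \<le> weight reduced C D"
    unfolding weight_reduced using sub sub' by (auto intro!: infsum_nonneg weight_nonneg)
  have bij: "bij_betw prod.swap (C \<times> D) (D \<times> C)" by (auto simp: bij_betw_def inj_on_def)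
  have "weight reduced D C = (\<Sum>\<^sub>\<infinity>p\<in>C \<times> D. (\<lambda>(x, y). weight G x y) (prod.swap p))"
    unfolding weight_reduced by (rule infsum_reindex_bij_betw[OF bij, symmetric])
  also have "\<dots> = weight reduced C D"
    unfolding weight_reduced using sub sub' weight_sym by (intro infsum_cong) auto
  finally show "weight reduced C D = weight reduced D C" by simp
qed (rule K_nonneg)

sublocale reduced: bounded_graph reduced K
  by (rule bounded_graph_reduced)

section \<open>The operators between the two sequence spaces\<close>

lemma J_up_eq: "J_up G F h v = (if v \<in> verts G then h (cluster v) else 0)"
proof (cases "v \<in> verts G")
  case True
  \<comment> \<open>Distinct components are disjoint, so only the term of the component of
    \<open>v\<close> survives.\<close>
  have "J_up G F h v = (\<Sum>\<^sub>\<infinity>C\<in>{cluster v}. h C * indicator C v)"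
    unfolding J_up_def using True cluster_of_member
    by (intro infsum_cong_neutral) (auto simp: indicator_def)
  then show ?thesis using True by (simp add: indicator_def)
next
  case False
  then show ?thesis
    unfolding J_up_def by (auto intro!: infsum_0 simp: indicator_def dest: reduced_vertex_subset[THEN subsetD])
qed

text \<open>The lifted function is constant on each cluster, so summing the masses there produces
  the factor \<open>mass reduced C\<close>; the nonnegative sums are then reassembled over the
  fibres of \<open>cluster\<close>.\<close>

lemma
  assumes h: "h \<in> ell2 reduced"
  shows J_up_in_ell2: "J_up G F h \<in> ell2 G"
    and ell2_norm_J_up: "ell2_norm G (J_up G F h) = ell2_norm reduced h"
proof -
  have fib: "((\<lambda>v. (cmod (J_up G F h v))\<^sup>2 * mass G v) has_sum (cmod (h C))\<^sup>2 * mass reduced C)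
      {x \<in> verts G. cluster x = C}" if C: "C \<in> verts reduced" for C
  proof -
    have "((\<lambda>v. (cmod (h C))\<^sup>2 * mass G v) has_sum (cmod (h C))\<^sup>2 * mass reduced C) C"
      unfolding mass_reduced by (intro has_sum_cmult_right has_sum_infsum mass_summable_reduced_vertex C)
    then show ?thesis
      unfolding cluster_fibre[OF C]
      by (rule has_sum_cong[THEN iffD1, rotated])
        (use C reduced_vertex_subset cluster_of_member in \<open>auto simp: J_up_eq\<close>)
  qed
  have cl: "cluster ` verts G \<subseteq> verts reduced" by auto
  note * = summable_on_if_fibres[OF _ cl fib reduced.ell2_summable[OF h]]
    infsum_if_fibres[OF _ cl fib reduced.ell2_summable[OF h]]
  show "J_up G F h \<in> ell2 G"
    unfolding ell2_def using *(1) by (auto simp: J_up_eq)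
  show "ell2_norm G (J_up G F h) = ell2_norm reduced h"
    unfolding ell2_norm_def using *(2) by simp
qed

text \<open>\<open>J_down\<close> averages over a cluster by mass. Cauchy-Schwarz against the
  constant function 1, with the mass split into square roots, bounds the squared modulus of the
  average by the average of the squares.\<close>

lemma
  assumes f: "f \<in> ell2 G" and C: "C \<in> verts reduced"
  shows cluster_integral_summable: "(\<lambda>x. f x * complex_of_real (mass G x)) summable_on C"
    and J_down_mass: "J_down G F f C * complex_of_real (mass reduced C)
      = (\<Sum>\<^sub>\<infinity>x\<in>C. f x * complex_of_real (mass G x))"
    and cmod_J_down_le: "(cmod (J_down G F f C))\<^sup>2 * mass reduced C \<le> (\<Sum>\<^sub>\<infinity>x\<in>C. (cmod (f x))\<^sup>2 * mass G x)"
proof -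
  note sub = reduced_vertex_subset[OF C]
  have m: "mass reduced C > 0" by (rule reduced.mass_pos[OF C])
  have fs: "(\<lambda>x. (cmod (f x))\<^sup>2 * mass G x) summable_on C"
    by (rule summable_on_subset_banach[OF ell2_summable[OF f] sub])
  have 1: "(sqrt (mass G x))\<^sup>2 = mass G x"
    "(sqrt (mass G x) * cmod (f x))\<^sup>2 = (cmod (f x))\<^sup>2 * mass G x"
    "\<bar>sqrt (mass G x)\<bar> * \<bar>sqrt (mass G x) * cmod (f x)\<bar> = cmod (f x) * mass G x"
    if "x \<in> C" for x
    using subsetD[OF sub that] by (auto simp: power_mult_distrib abs_mult)
  have sq: "(\<lambda>x. (sqrt (mass G x))\<^sup>2) summable_on C" "(\<lambda>x. (sqrt (mass G x) * cmod (f x))\<^sup>2) summable_on C"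
    using mass_summable_reduced_vertex[OF C] fs 1 by (simp_all cong: summable_on_cong)
  note cs = cauchy_schwarz_infsum[OF sq]
  have cs1: "(\<lambda>x. cmod (f x) * mass G x) summable_on C"
    using cs(1) 1 by (simp cong: summable_on_cong)
  have cs2: "(\<Sum>\<^sub>\<infinity>x\<in>C. cmod (f x) * mass G x) \<le> sqrt (mass reduced C) * sqrt (\<Sum>\<^sub>\<infinity>x\<in>C. (cmod (f x))\<^sup>2 * mass G x)"
    using cs(2) 1 by (simp add: mass_reduced cong: infsum_cong)
  have le: "cmod (f x * complex_of_real (mass G x)) \<le> cmod (f x) * mass G x" if "x \<in> C" for x
    using subsetD[OF sub that] by (simp add: norm_mult)
  note s = cmod_infsum_le_infsum[OF cs1 le]
  show "(\<lambda>x. f x * complex_of_real (mass G x)) summable_on C" by (rule s(1))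
  have "ell2_inner G (indicator C) f = (\<Sum>\<^sub>\<infinity>x\<in>C. f x * complex_of_real (mass G x))"
    unfolding ell2_inner_def using sub by (intro infsum_cong_neutral) (auto simp: indicator_def)
  then show J: "J_down G F f C * complex_of_real (mass reduced C) = (\<Sum>\<^sub>\<infinity>x\<in>C. f x * complex_of_real (mass G x))"
    using C m by (simp add: J_down_def)
  have nn: "0 \<le> (\<Sum>\<^sub>\<infinity>x\<in>C. (cmod (f x))\<^sup>2 * mass G x)"
    using sub by (auto intro!: infsum_nonneg)
  have "cmod (J_down G F f C) * mass reduced C = cmod (J_down G F f C * complex_of_real (mass reduced C))"
    using m by (simp add: norm_mult)
  also have "\<dots> \<le> sqrt (mass reduced C) * sqrt (\<Sum>\<^sub>\<infinity>x\<in>C. (cmod (f x))\<^sup>2 * mass G x)"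
    unfolding J using s(2) cs2 by linarith
  finally have "(cmod (J_down G F f C) * mass reduced C)\<^sup>2
      \<le> (sqrt (mass reduced C) * sqrt (\<Sum>\<^sub>\<infinity>x\<in>C. (cmod (f x))\<^sup>2 * mass G x))\<^sup>2"
    using m by (intro power_mono) auto
  then have "mass reduced C * ((cmod (J_down G F f C))\<^sup>2 * mass reduced C)
      \<le> mass reduced C * (\<Sum>\<^sub>\<infinity>x\<in>C. (cmod (f x))\<^sup>2 * mass G x)"
    using m nn by (simp add: power_mult_distrib power2_eq_square[of "mass reduced C"] mult_ac)
  then show "(cmod (J_down G F f C))\<^sup>2 * mass reduced C \<le> (\<Sum>\<^sub>\<infinity>x\<in>C. (cmod (f x))\<^sup>2 * mass G x)"
    using m by (simp only: mult_le_cancel_left_pos)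
qed

lemma J_down_outside: "C \<notin> verts reduced \<Longrightarrow> J_down G F f C = 0"
  by (simp add: J_down_def)

lemma
  assumes f: "f \<in> ell2 G"
  shows J_down_in_ell2: "J_down G F f \<in> ell2 reduced"
    and ell2_norm_J_down_le: "ell2_norm reduced (J_down G F f) \<le> ell2_norm G f"
proof -
  note cl = summable_on_clusters[OF ell2_summable[OF f]] infsum_clusters[OF ell2_summable[OF f]]
  have s: "(\<lambda>C. (cmod (J_down G F f C))\<^sup>2 * mass reduced C) summable_on verts reduced"
    by (rule summable_on_comparison_test[OF cl(1) cmod_J_down_le[OF f]]) auto
  then show "J_down G F f \<in> ell2 reduced"
    by (simp add: ell2_def J_down_outside)
  show "ell2_norm reduced (J_down G F f) \<le> ell2_norm G f"
    unfolding ell2_norm_def cl(2)[symmetric]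
    by (rule real_sqrt_le_mono[OF infsum_mono[OF s cl(1) cmod_J_down_le[OF f]]])
qed

text \<open>A function constant on clusters agrees with its averages. Hence \<open>J_up\<close>
  after \<open>J_down\<close> is a projection onto such functions.\<close>

lemma J_down_J_up:
  assumes h: "h \<in> ell2 reduced"
  shows "J_down G F (J_up G F h) = h"
proof
  fix C
  show "J_down G F (J_up G F h) C = h C"
  proof (cases "C \<in> verts reduced")
    case True
    have "J_down G F (J_up G F h) C * complex_of_real (mass reduced C)
        = (\<Sum>\<^sub>\<infinity>x\<in>C. h C * complex_of_real (mass G x))"
      unfolding J_down_mass[OF J_up_in_ell2[OF h] True]
      by (rule infsum_cong) (use reduced_vertex_subset[OF True] cluster_of_member[OF True] in \<open>auto simp: J_up_eq\<close>)
    also have "\<dots> = h C * complex_of_real (mass reduced C)"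
      unfolding mass_reduced
      by (intro infsumI has_sum_cmult_right has_sum_of_real has_sum_infsum mass_summable_reduced_vertex True)
    finally show ?thesis using reduced.mass_pos[OF True] by simp
  qed (use reduced.ell2_vanishes[OF h] in \<open>simp add: J_down_def\<close>)
qed

lemma J_down_add:
  assumes f: "f \<in> ell2 G" and g: "g \<in> ell2 G"
  shows "J_down G F (\<lambda>v. f v + g v) = (\<lambda>C. J_down G F f C + J_down G F g C)"
proof
  fix C
  show "J_down G F (\<lambda>v. f v + g v) C = J_down G F f C + J_down G F g C"
  proof (cases "C \<in> verts reduced")
    case True
    have "J_down G F (\<lambda>v. f v + g v) C * complex_of_real (mass reduced C)
       = (J_down G F f C + J_down G F g C) * complex_of_real (mass reduced C)"
      unfolding distrib_right J_down_mass[OF ell2_add[OF f g] True] J_down_mass[OF f True] J_down_mass[OF g True]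
      by (intro infsum_add cluster_integral_summable f g True)
    then show ?thesis using reduced.mass_pos[OF True] by simp
  qed (simp add: J_down_def)
qed

lemma J_down_scale: "J_down G F (\<lambda>v. c * f v) = (\<lambda>C. c * J_down G F f C)"
proof
  fix C show "J_down G F (\<lambda>v. c * f v) C = c * J_down G F f C"
    by (cases "C \<in> verts reduced") (simp_all add: J_down_def ell2_inner_scale_right)
qed

lemma bounded_operator_J_down: "bounded_operator G reduced (J_down G F)"
  unfolding bounded_operator_def
proof (intro conjI ballI allI exI)
  fix f assume f: "f \<in> ell2 G"
  show "ell2_norm reduced (J_down G F f) \<le> 1 * ell2_norm G f"
    using ell2_norm_J_down_le[OF f] by simp
qed (simp_all only: J_down_in_ell2 J_down_add J_down_scale)

lemma bounded_operator_J_up: "bounded_operator reduced G (J_up G F)"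
  unfolding bounded_operator_def
proof (intro conjI ballI allI exI)
  fix h assume h: "h \<in> ell2 reduced"
  show "ell2_norm G (J_up G F h) \<le> 1 * ell2_norm reduced h"
    using ell2_norm_J_up[OF h] by simp
qed (auto simp: J_up_in_ell2 J_up_eq)

text \<open>Multiplied by the mass of \<open>C\<close>, the average of the Laplacian is the sum of
  the weighted differences over the strip \<open>C \<times> verts G\<close>. On each block
  \<open>C \<times> D\<close> of the strip the difference is the constant \<open>h C - h D\<close>,
  which produces the reduced Laplacian. The block \<open>C \<times> C\<close> contributes 0, so
  edges inside a cluster drop out.\<close>

lemma J_down_laplacian_J_up:
  assumes h: "h \<in> ell2 reduced"
  shows "J_down G F (laplacian G (J_up G F h)) = laplacian reduced h"
proof
  fix C
  define u where "u = J_up G F h"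
  have u: "u \<in> ell2 G" unfolding u_def by (rule J_up_in_ell2[OF h])
  show "J_down G F (laplacian G (J_up G F h)) C = laplacian reduced h C"
    unfolding u_def[symmetric]
  proof (cases "C \<in> verts reduced")
    case True
    note sub = reduced_vertex_subset[OF True]
    let ?f = "\<lambda>(x, y). complex_of_real (weight G x y) * (u x - u y)"
    have e: "(\<lambda>(x, y). weight G x y * (cmod (u x - u y))\<^sup>2) summable_on C \<times> verts G"
      by (rule summable_on_subset_banach[OF energy_summable[OF u]]) (use sub in auto)
    \<comment> \<open>The strip has finite total weight and finite energy, so bounding
      \<open>t\<close> by \<open>1 + t\<^sup>2\<close> gives absolute summability over it.\<close>
    have le: "cmod (?f p) \<le> (\<lambda>(x, y). weight G x y) p + (\<lambda>(x, y). weight G x y * (cmod (u x - u y))\<^sup>2) p"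
      if pC: "p \<in> C \<times> verts G" for p
    proof -
      obtain x y where p: "p = (x, y)" "x \<in> verts G" "y \<in> verts G" using pC sub by auto
      have "cmod (u x - u y) \<le> 1 + (cmod (u x - u y))\<^sup>2"
        using sum_squares_bound[of 1 "cmod (u x - u y)"] norm_ge_zero[of "u x - u y"] by (simp del: norm_ge_zero)
      from mult_left_mono[OF this weight_nonneg[OF p(2,3)]] show ?thesis
        using weight_nonneg[OF p(2,3)] by (simp add: p norm_mult distrib_left)
    qed
    have f: "?f summable_on C \<times> verts G"
      by (rule cmod_infsum_le_infsum(1)[OF summable_on_add[OF weight_summable_strip[OF True] e] le])
    have "J_down G F (laplacian G u) C * complex_of_real (mass reduced C)
        = (\<Sum>\<^sub>\<infinity>x\<in>C. \<Sum>\<^sub>\<infinity>y\<in>verts G. ?f (x, y))"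
      unfolding J_down_mass[OF laplacian_in_ell2[OF u] True]
      by (rule infsum_cong) (use laplacian_mass[OF u] sub in auto)
    also have "\<dots> = (\<Sum>\<^sub>\<infinity>D\<in>verts reduced. infsum ?f (C \<times> D))"
      using infsum_Sigma_banach[OF f] infsum_cluster_columns[OF f] by simp
    also have "\<dots> = (\<Sum>\<^sub>\<infinity>D\<in>verts reduced. complex_of_real (weight reduced C D) * (h C - h D))"
    proof (rule infsum_cong)
      fix D assume D: "D \<in> verts reduced"
      note sub' = reduced_vertex_subset[OF D]
      have ws: "(\<lambda>(x, y). weight G x y) summable_on C \<times> D"
        by (rule summable_on_subset_banach[OF weight_summable_strip[OF True]]) (use sub' in auto)
      have "infsum ?f (C \<times> D) = (\<Sum>\<^sub>\<infinity>p\<in>C \<times> D. complex_of_real ((\<lambda>(x, y). weight G x y) p) * (h C - h D))"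
        by (rule infsum_cong)
          (use sub sub' cluster_of_member[OF True] cluster_of_member[OF D] in \<open>auto simp: u_def J_up_eq\<close>)
      also have "\<dots> = complex_of_real (weight reduced C D) * (h C - h D)"
        unfolding weight_reduced by (intro infsumI has_sum_cmult_left has_sum_of_real has_sum_infsum ws)
      finally show "infsum ?f (C \<times> D) = complex_of_real (weight reduced C D) * (h C - h D)" .
    qed
    also have "\<dots> = laplacian reduced h C * complex_of_real (mass reduced C)"
      by (rule reduced.laplacian_mass[OF h True, symmetric])
    finally show "J_down G F (laplacian G u) C = laplacian reduced h C"
      using reduced.mass_pos[OF True] by simp
  qed (simp add: J_down_def laplacian_def)
qed

text \<open>On each cluster the lifted function is a constant and can be pulled out, leaving the
  conjugate of the average of \<open>w\<close> times the mass.\<close>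

lemma ell2_inner_J_up_eq_0:
  assumes w: "w \<in> ell2 G" "J_down G F w = (\<lambda>_. 0)" and h: "h \<in> ell2 reduced"
  shows "ell2_inner G w (J_up G F h) = 0"
proof -
  let ?f = "\<lambda>v. cnj (w v) * J_up G F h v * complex_of_real (mass G v)"
  have "infsum ?f C = 0" if C: "C \<in> verts reduced" for C
  proof -
    have "infsum ?f C = (\<Sum>\<^sub>\<infinity>x\<in>C. h C * cnj (w x * complex_of_real (mass G x)))"
      by (rule infsum_cong) (use reduced_vertex_subset[OF C] cluster_of_member[OF C] in \<open>auto simp: J_up_eq\<close>)
    also have "\<dots> = h C * cnj (J_down G F w C * complex_of_real (mass reduced C))"
      unfolding J_down_mass[OF w(1) C] by (simp only: infsum_cmult_right' infsum_cnj)
    finally show ?thesis by (simp add: w(2))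
  qed
  then show ?thesis
    unfolding ell2_inner_def infsum_clusters[OF ell2_inner_summable[OF w(1) J_up_in_ell2[OF h]], symmetric]
    by (rule infsum_0)
qed

end

section \<open>Weak convergence and the limit of large weights\<close>

context positive_masses
begin

lemma
  assumes f: "f \<in> ell2 G"
  shows ell2_restrict: "(\<lambda>v. if v \<in> A then f v else 0) \<in> ell2 G"
    and ell2_norm_restrict_le: "ell2_norm G (\<lambda>v. if v \<in> A then f v else 0) \<le> ell2_norm G f"
proof -
  let ?r = "\<lambda>v. if v \<in> A then f v else 0"
  have le: "(cmod (?r v))\<^sup>2 * mass G v \<le> (cmod (f v))\<^sup>2 * mass G v" if "v \<in> verts G" for v
    using that by simp
  have s: "(\<lambda>v. (cmod (?r v))\<^sup>2 * mass G v) summable_on verts G"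
    by (rule summable_on_comparison_test[OF ell2_summable[OF f] le]) auto
  then show "?r \<in> ell2 G" using ell2_vanishes[OF f] by (simp add: ell2_def)
  show "ell2_norm G ?r \<le> ell2_norm G f"
    unfolding ell2_norm_def by (rule real_sqrt_le_mono[OF infsum_mono[OF s ell2_summable[OF f] le]])
qed

lemma ell2_finite_approximation:
  assumes f: "f \<in> ell2 G" and e: "e > 0"
  obtains A where "finite A" "A \<subseteq> verts G" "ell2_norm G (\<lambda>v. if v \<in> verts G - A then f v else 0) < e"
proof -
  let ?s = "\<lambda>v. (cmod (f v))\<^sup>2 * mass G v"
  have "0 < (e / 2)\<^sup>2" using e by simp
  from infsum_finite_approximation[OF ell2_summable[OF f] this]
  obtain A where A: "finite A" "A \<subseteq> verts G" "dist (sum ?s A) (infsum ?s (verts G)) \<le> (e / 2)\<^sup>2"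
    by blast
  have "infsum ?s (verts G) = infsum ?s A + infsum ?s (verts G - A)"
    using infsum_Un_disjoint[of ?s A "verts G - A"] A summable_on_subset_banach[OF ell2_summable[OF f], of "verts G - A"]
    by (simp add: Un_absorb1)
  then have "infsum ?s (verts G - A) \<le> (e / 2)\<^sup>2"
    using A by (simp add: dist_real_def)
  moreover have "(\<Sum>\<^sub>\<infinity>v\<in>verts G. (cmod (if v \<in> verts G - A then f v else 0))\<^sup>2 * mass G v) = infsum ?s (verts G - A)"
    by (rule infsum_cong_neutral) auto
  ultimately have "ell2_norm G (\<lambda>v. if v \<in> verts G - A then f v else 0) \<le> e / 2"
    unfolding ell2_norm_def using e by (intro real_le_lsqrt) auto
  with A e that show ?thesis by simp
qed

text \<open>Weak convergence from boundedness and pointwise convergence: \<open>g\<close> splits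
  into finitely many values, on which the inner product converges termwise, and a small tail, which
  Cauchy-Schwarz controls.\<close>

lemma tendsto_ell2_inner_pointwise:
  assumes v: "\<forall>\<^sub>F t in L. v t \<in> ell2 G \<and> ell2_norm G (v t) \<le> B"
    and lim: "\<And>x. x \<in> verts G \<Longrightarrow> ((\<lambda>t. v t x) \<longlongrightarrow> 0) L"
    and g: "g \<in> ell2 G"
  shows "((\<lambda>t. ell2_inner G g (v t)) \<longlongrightarrow> 0) L"
proof (rule tendstoI)
  fix e :: real assume e: "e > 0"
  \<comment> \<open>The tail contributes at most \<open>\<eta>\<close> times the bound, hence at
    most \<open>e / 2\<close>; \<open>\<bar>B\<bar> + 1\<close> is positive whatever the sign of
    \<open>B\<close>.\<close>
  define \<eta> where "\<eta> = e / (2 * (\<bar>B\<bar> + 1))"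
  have \<eta>: "\<eta> > 0" "\<eta> * (\<bar>B\<bar> + 1) = e / 2" using e by (auto simp: \<eta>_def field_simps)
  obtain A where A: "finite A" "A \<subseteq> verts G" "ell2_norm G (\<lambda>v. if v \<in> verts G - A then g v else 0) < \<eta>"
    using ell2_finite_approximation[OF g \<eta>(1)] .
  define r where "r = (\<lambda>v. if v \<in> verts G - A then g v else 0)"
  have r: "r \<in> ell2 G" unfolding r_def by (rule ell2_restrict[OF g])
  let ?f = "\<lambda>t. \<Sum>x\<in>A. cnj (g x) * v t x * complex_of_real (mass G x)"
  have "(?f \<longlongrightarrow> (\<Sum>x\<in>A. cnj (g x) * 0 * complex_of_real (mass G x))) L"
    using A(2) by (intro tendsto_sum tendsto_intros lim) auto
  then have "\<forall>\<^sub>F t in L. dist (?f t) 0 < e / 2"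
    using e by (intro tendstoD) auto
  with v show "\<forall>\<^sub>F t in L. dist (ell2_inner G g (v t)) 0 < e"
  proof eventually_elim
    case (elim t)
    then have vt: "v t \<in> ell2 G" "ell2_norm G (v t) \<le> B" by auto
    let ?h = "\<lambda>x. cnj (g x) * v t x * complex_of_real (mass G x)"
    have "infsum ?h (verts G) = infsum ?h A + infsum ?h (verts G - A)"
      using infsum_Un_disjoint[of ?h A "verts G - A"] A
        summable_on_subset_banach[OF ell2_inner_summable[OF g vt(1)], of "verts G - A"]
      by (simp add: Un_absorb1)
    moreover have "infsum ?h (verts G - A) = ell2_inner G r (v t)"
      unfolding ell2_inner_def r_def by (rule infsum_cong_neutral) auto
    ultimately have "ell2_inner G g (v t) = ?f t + ell2_inner G r (v t)"
      using A(1) by (simp add: ell2_inner_def)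
    then have "cmod (ell2_inner G g (v t)) \<le> cmod (?f t) + cmod (ell2_inner G r (v t))"
      using norm_triangle_ineq by metis
    moreover have "cmod (ell2_inner G r (v t)) \<le> \<eta> * (\<bar>B\<bar> + 1)"
    proof (rule order_trans[OF ell2_cauchy_schwarz[OF r vt(1)]])
      show "ell2_norm G r * ell2_norm G (v t) \<le> \<eta> * (\<bar>B\<bar> + 1)"
        using A(3) vt(2) \<eta>(1) by (intro mult_mono) (auto simp: r_def)
    qed
    ultimately show ?case using elim(2) \<eta>(2) by simp
  qed
qed

end

section \<open>Cluster averages and orthogonality\<close>

context clustered_graph
begin

lemma indicator_cluster_in_ell2:
  assumes "C \<in> verts reduced"
  shows "indicator C \<in> ell2 G"
proof -
  have "(\<lambda>v. (cmod (indicator C v))\<^sup>2 * mass G v) summable_on verts G \<longleftrightarrow> mass G summable_on C"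
    by (rule summable_on_cong_neutral)
      (use reduced_vertex_subset[OF assms] in \<open>auto simp: indicator_def\<close>)
  then show ?thesis
    using mass_summable_reduced_vertex[OF assms] reduced_vertex_subset[OF assms]
    by (auto simp: ell2_def indicator_def)
qed

lemma J_down_mass_eq_inner:
  assumes "C \<in> verts reduced"
  shows "J_down G F f C * complex_of_real (mass reduced C) = ell2_inner G (indicator C) f"
  using reduced.mass_pos[OF assms] assms by (simp add: J_down_def)

lemma ell2_inner_indicator_self:
  assumes "C \<in> verts reduced"
  shows "ell2_inner G (indicator C) (indicator C) = complex_of_real (mass reduced C)"
proof -
  have "ell2_inner G (indicator C) (indicator C) = (\<Sum>\<^sub>\<infinity>v\<in>C. complex_of_real (mass G v))"
    unfolding ell2_inner_def
    by (rule infsum_cong_neutral) (use reduced_vertex_subset[OF assms] in \<open>auto simp: indicator_def\<close>)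
  also have "\<dots> = complex_of_real (mass reduced C)"
    unfolding mass_reduced by (intro infsumI has_sum_of_real has_sum_infsum mass_summable_reduced_vertex assms)
  finally show ?thesis .
qed

text \<open>Two vertices of a cluster are joined by a finite path in \<open>F\<close>, along which
  the differences telescope. The rate may depend on the path, so on an infinite cluster the
  convergence need not be uniform.\<close>

lemma tendsto_0_on_cluster:
  assumes "\<And>i j. (i, j) \<in> F \<Longrightarrow> ((\<lambda>t. v t i - v t j :: complex) \<longlongrightarrow> 0) L" and "(x, y) \<in> F\<^sup>*"
  shows "((\<lambda>t. v t x - v t y) \<longlongrightarrow> 0) L"
  using assms(2)
proof (induction rule: rtrancl_induct)
  case (step y z)
  from tendsto_add[OF step.IH assms(1)[OF step.hyps(2)]] show ?case by simp
qed simp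

text \<open>The difference in question is the average of \<open>v t x - v t u\<close> over
  \<open>u\<close> in the cluster. Pointwise convergence in \<open>u\<close> does not suffice on an
  infinite cluster; boundedness upgrades it to weak convergence, tested against the indicator of the
  cluster.\<close>

lemma tendsto_minus_average:
  assumes v: "\<forall>\<^sub>F t in L. v t \<in> ell2 G \<and> ell2_norm G (v t) \<le> B"
    and edge: "\<And>i j. (i, j) \<in> F \<Longrightarrow> ((\<lambda>t. v t i - v t j) \<longlongrightarrow> 0) L"
    and x: "x \<in> verts G"
  shows "((\<lambda>t. v t x - J_up G F (J_down G F (v t)) x) \<longlongrightarrow> 0) L"
proof -
  define C where "C = cluster x"
  have C: "C \<in> verts reduced" unfolding C_def using x by simp
  note ind = indicator_cluster_in_ell2[OF C]
  note m = mass_pos[OF x] reduced.mass_pos[OF C]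
  \<comment> \<open>pairing \<open>y t\<close> with \<open>indicator C\<close> gives \<open>mass reduced C\<close> times the quantity in the claim\<close>
  define y where "y t = (\<lambda>u. v t x * indicator C u - (if u \<in> C then v t u else 0))" for t
  \<comment> \<open>Evaluation at \<open>x\<close> costs a factor
    \<open>1 / sqrt (mass G x)\<close>, and restriction to \<open>C\<close> does not increase the
    norm.\<close>
  define M where "M = B / sqrt (mass G x) * ell2_norm G (indicator C) + B"
  have y: "\<forall>\<^sub>F t in L. y t \<in> ell2 G \<and> ell2_norm G (y t) \<le> M"
    using v
  proof eventually_elim
    case (elim t)
    then have vt: "v t \<in> ell2 G" "ell2_norm G (v t) \<le> B" by auto
    have "cmod (v t x) * sqrt (mass G x) \<le> B"
      using ell2_pointwise[OF vt(1) x] vt(2) by linarith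
    then have vx: "cmod (v t x) \<le> B / sqrt (mass G x)" using m(1) by (simp add: field_simps)
    have "ell2_norm G (y t) \<le> cmod (v t x) * ell2_norm G (indicator C) + ell2_norm G (\<lambda>u. if u \<in> C then v t u else 0)"
      unfolding y_def ell2_norm_scale[symmetric]
      by (rule ell2_norm_diff_triangle[OF ell2_scale[OF ind] ell2_restrict[OF vt(1)]])
    also have "\<dots> \<le> M"
      unfolding M_def using ell2_norm_restrict_le[OF vt(1), of C] vt(2)
      by (intro add_mono mult_right_mono vx) auto
    finally show ?case
      unfolding y_def using ell2_diff[OF ell2_scale[OF ind] ell2_restrict[OF vt(1)]] by simp
  qed
  have "((\<lambda>t. y t u) \<longlongrightarrow> 0) L" for u
  proof (cases "u \<in> C")
    case True
    then have "(x, u) \<in> F\<^sup>*" by (simp add: C_def)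
    from tendsto_0_on_cluster[OF edge this] show ?thesis using True by (simp add: y_def)
  qed (simp add: y_def)
  from tendsto_ell2_inner_pointwise[OF y this ind]
  have "((\<lambda>t. ell2_inner G (indicator C) (y t) / complex_of_real (mass reduced C)) \<longlongrightarrow> 0 / complex_of_real (mass reduced C)) L"
    using m by (intro tendsto_divide tendsto_const) auto
  moreover have "\<forall>\<^sub>F t in L. ell2_inner G (indicator C) (y t) / complex_of_real (mass reduced C)
      = v t x - J_up G F (J_down G F (v t)) x"
    using v
  proof eventually_elim
    case (elim t)
    then have vt: "v t \<in> ell2 G" by auto
    have "ell2_inner G (indicator C) (\<lambda>u. if u \<in> C then v t u else 0) = ell2_inner G (indicator C) (v t)"
      unfolding ell2_inner_def by (intro infsum_cong) (auto simp: indicator_def)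
    then have "ell2_inner G (indicator C) (y t)
        = v t x * complex_of_real (mass reduced C) - J_down G F (v t) C * complex_of_real (mass reduced C)"
      unfolding y_def ell2_inner_diff_right[OF ind ell2_scale[OF ind] ell2_restrict[OF vt]]
        ell2_inner_scale_right ell2_inner_indicator_self[OF C] J_down_mass_eq_inner[OF C] by simp
    then show ?case using m x by (simp add: J_up_eq C_def field_simps)
  qed
  ultimately show ?thesis using tendsto_cong by force
qed

text \<open>\<open>w\<close> is orthogonal to functions constant on clusters, so the averages may be
  subtracted from \<open>v t\<close>. What remains is bounded by \<open>2 * B\<close>, averaging
  being a contraction, and tends to 0 pointwise.\<close>

lemma tendsto_ell2_inner_zero_average:
  assumes v: "\<forall>\<^sub>F t in L. v t \<in> ell2 G \<and> ell2_norm G (v t) \<le> B"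
    and edge: "\<And>i j. (i, j) \<in> F \<Longrightarrow> ((\<lambda>t. v t i - v t j) \<longlongrightarrow> 0) L"
    and w: "w \<in> ell2 G" "J_down G F w = (\<lambda>_. 0)"
  shows "((\<lambda>t. ell2_inner G w (v t)) \<longlongrightarrow> 0) L"
proof -
  define d where "d t = (\<lambda>x. v t x - J_up G F (J_down G F (v t)) x)" for t
  have P: "J_up G F (J_down G F f) \<in> ell2 G" "ell2_norm G (J_up G F (J_down G F f)) \<le> ell2_norm G f"
    if "f \<in> ell2 G" for f
    using J_up_in_ell2 ell2_norm_J_up J_down_in_ell2[OF that] ell2_norm_J_down_le[OF that] by auto
  have d: "\<forall>\<^sub>F t in L. d t \<in> ell2 G \<and> ell2_norm G (d t) \<le> 2 * B"
    using v
  proof eventually_elim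
    case (elim t)
    then have vt: "v t \<in> ell2 G" "ell2_norm G (v t) \<le> B" by auto
    show ?case
      unfolding d_def using ell2_diff[OF vt(1) P(1)[OF vt(1)]]
        ell2_norm_diff_triangle[OF vt(1) P(1)[OF vt(1)]] P(2)[OF vt(1)] vt(2) by simp
  qed
  have "((\<lambda>t. ell2_inner G w (d t)) \<longlongrightarrow> 0) L"
    by (rule tendsto_ell2_inner_pointwise[OF d _ w(1)])
      (unfold d_def, rule tendsto_minus_average[OF v edge])
  moreover have "\<forall>\<^sub>F t in L. ell2_inner G w (d t) = ell2_inner G w (v t)"
    using v
  proof eventually_elim
    case (elim t)
    then have vt: "v t \<in> ell2 G" by auto
    show ?case
      unfolding d_def ell2_inner_diff_right[OF w(1) vt P(1)[OF vt]] ell2_inner_J_up_eq_0[OF w J_down_in_ell2[OF vt]]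
      by simp
  qed
  ultimately show ?thesis using tendsto_cong by force
qed

end

section \<open>From the hypotheses on graphs and clusters to the locales\<close>

lemma weight_eq_0_if_no_edge:
  assumes "weighted_graph G" "v \<in> verts G" "w \<in> verts G" "(v, w) \<notin> edges G"
  shows "weight G v w = 0"
proof -
  have "0 \<le> weight G v w" "weight G v w > 0 \<longleftrightarrow> (v, w) \<in> edges G"
    using assms(1-3) unfolding weighted_graph_def by blast+
  then show ?thesis using assms(4) by linarith
qed

lemma bounded_graph_if_undirected:
  assumes "undirected_graph G" "degree_bounded G"
  obtains K where "bounded_graph G K"
proof -
  obtain K where K: "K > 0" "\<And>v. v \<in> verts G \<Longrightarrow> degree G v \<le> K * mass G v"
    using assms(2) by (auto simp: degree_bounded_def)
  have wg: "weighted_graph G" using assms(1) by (simp add: undirected_graph_def)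
  have "bounded_graph G K"
  proof
    fix v assume v: "v \<in> verts G"
    show "mass G v > 0" "degree G v \<le> K * mass G v"
      using wg v K by (auto simp: weighted_graph_def)
    have "{w \<in> verts G. weight G v w \<noteq> 0} \<subseteq> edges G `` {v}"
    proof
      fix w assume w: "w \<in> {w \<in> verts G. weight G v w \<noteq> 0}"
      then show "w \<in> edges G `` {v}" using weight_eq_0_if_no_edge[OF wg v, of w] by auto
    qed
    moreover have "finite (edges G `` {v})" using wg v by (auto simp: weighted_graph_def)
    ultimately have "finite {w \<in> verts G. weight G v w \<noteq> 0}" by (rule finite_subset)
    then show "weight G v summable_on verts G"
      by (rule finite_nonzero_values_imp_summable_on)
    fix w assume w: "w \<in> verts G"
    show "0 \<le> weight G v w" "weight G v w = weight G w v"
      using wg assms(1) v w by (auto simp: weighted_graph_def undirected_graph_def)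
  qed (use K in auto)
  then show ?thesis by (rule that)
qed

text \<open>A first edge leading out of the node set would belong to another cluster that contains a
  vertex of this one, against disjointness.\<close>

lemma cluster_of_union:
  assumes cl: "undirected_clusters G I Eh" and i: "i \<in> I" "x \<in> Field (Eh i)"
    and xy: "(x, y) \<in> (\<Union>i\<in>I. Eh i)\<^sup>*"
  shows "y \<in> Field (Eh i)"
  using xy
proof (induction rule: rtrancl_induct)
  case base
  show ?case by (rule i(2))
next
  case (step y z)
  then obtain j where j: "j \<in> I" "(y, z) \<in> Eh j" by auto
  then have "y \<in> Field (Eh j)" and z: "z \<in> Field (Eh j)" by (auto intro: FieldI1 FieldI2)
  moreover have "Field (Eh i) \<inter> Field (Eh j) = {}" if "i \<noteq> j"
    using cl i(1) j(1) that by (simp add: undirected_clusters_def disjoint_family_on_def)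
  ultimately have "i = j" using step.IH by blast
  with z show ?case by simp
qed

text \<open>A component that meets a cluster stays in its node set, whose mass is finite; any other
  component is a single vertex.\<close>

lemma clustered_graph_if_undirected_clusters:
  assumes "bounded_graph G K" and edges: "edges G \<subseteq> verts G \<times> verts G"
    and cl: "undirected_clusters G I Eh"
  shows "clustered_graph G K (\<Union>i\<in>I. Eh i)"
proof -
  interpret bounded_graph G K by fact
  let ?F = "\<Union>i\<in>I. Eh i"
  show ?thesis
  proof
    have Eh: "Eh i \<subseteq> edges G" "sym (Eh i)" if "i \<in> I" for i
      using cl that by (auto simp: undirected_clusters_def)
    show "?F \<subseteq> verts G \<times> verts G" using Eh(1) edges by blast
    show "sym ?F" using Eh(2) by (intro symI) (meson UN_iff symD)
    fix x assume x: "x \<in> verts G"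
    show "mass G summable_on ?F\<^sup>* `` {x}"
    proof (cases "x \<in> Field ?F")
      case True
      then obtain i where i: "i \<in> I" "x \<in> Field (Eh i)" by (auto simp: Field_def)
      have "?F\<^sup>* `` {x} \<subseteq> Field (Eh i)" using cluster_of_union[OF cl i] by auto
      then show ?thesis
        using cl i(1) summable_on_subset_banach by (fastforce simp: undirected_clusters_def)
    next
      case False
      have "?F\<^sup>* `` {x} = {x}"
      proof -
        have "y = x" if "(x, y) \<in> ?F\<^sup>*" for y
          using that False by (auto elim: converse_rtranclE intro: FieldI1)
        then show ?thesis by auto
      qed
      then show ?thesis by simp
    qed
  qed
qed

text \<open>The sequence space depends on vertices and masses alone. Statements proved in
  \<open>G\<beta> \<beta>\<close> can thus be read in \<open>G\<close>, although the Laplacians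
  differ.\<close>

lemma ell2_cong:
  assumes "verts H = verts G" "mass H = mass G"
  shows "ell2 H = ell2 G" "ell2_norm H = ell2_norm G" "ell2_inner H = ell2_inner G"
    "resolvent_set H = resolvent_set G"
proof -
  show ell2: "ell2 H = ell2 G" and norm: "ell2_norm H = ell2_norm G"
    using assms by (simp_all add: ell2_def ell2_norm_def[abs_def])
  show "ell2_inner H = ell2_inner G"
    using assms by (simp add: ell2_inner_def[abs_def])
  show "resolvent_set H = resolvent_set G"
    by (simp add: resolvent_def[abs_def] bounded_operator_def resolvent_set_def[abs_def] ell2 norm)
qed

lemma bounded_operator_comp:
  assumes H: "positive_masses H" and T: "bounded_operator G H T" and S: "bounded_operator H W S"
  shows "bounded_operator G W (S \<circ> T)"
proof -
  obtain K where K: "\<And>f. f \<in> ell2 G \<Longrightarrow> ell2_norm H (T f) \<le> K * ell2_norm G f"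
    using T unfolding bounded_operator_def by blast
  obtain M where M: "\<And>f. f \<in> ell2 H \<Longrightarrow> ell2_norm W (S f) \<le> M * ell2_norm H f"
    using S unfolding bounded_operator_def by blast
  show ?thesis
    unfolding bounded_operator_def
  proof (intro conjI ballI allI exI)
    fix f assume f: "f \<in> ell2 G"
    have Tf: "T f \<in> ell2 H" using T f unfolding bounded_operator_def by blast
    show "(S \<circ> T) f \<in> ell2 W" using S Tf unfolding bounded_operator_def by simp
    show "ell2_norm W ((S \<circ> T) f) \<le> (\<bar>M\<bar> * K) * ell2_norm G f"
    proof -
      have "M * ell2_norm H (T f) \<le> \<bar>M\<bar> * ell2_norm H (T f)"
        by (intro mult_right_mono positive_masses.ell2_norm_nonneg[OF H]) auto
      also have "\<dots> \<le> \<bar>M\<bar> * (K * ell2_norm G f)" by (intro mult_left_mono K f) auto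
      finally show ?thesis using M[OF Tf] by simp
    qed
    show "(S \<circ> T) (\<lambda>v. c * f v) = (\<lambda>w. c * (S \<circ> T) f w)" for c
      using T S f Tf unfolding bounded_operator_def by simp
    show "(S \<circ> T) (\<lambda>v. f v + g v) = (\<lambda>w. (S \<circ> T) f w + (S \<circ> T) g w)" if "g \<in> ell2 G" for g
      using T S f Tf that unfolding bounded_operator_def by simp
  qed
qed

section \<open>Strong convergence of the resolvents\<close>

theorem theorem3p5:
  fixes G :: "'a wgraph"
    and I :: "'i set"
    and Eh :: "'i \<Rightarrow> ('a \<times> 'a) set"
    and Ehat :: "('a \<times> 'a) set"
    and a :: "real \<Rightarrow> 'a \<Rightarrow> 'a \<Rightarrow> real"
    and G\<beta> :: "real \<Rightarrow> 'a wgraph"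
    and z :: complex
  assumes G: "undirected_graph G" "degree_bounded G"
    and clusters: "undirected_clusters G I Eh"
    and Ehat: "Ehat = (\<Union>i\<in>I. Eh i)"
    and G\<beta>_eq: "\<And>\<beta>. \<beta> \<ge> 0 \<Longrightarrow>
      G\<beta> \<beta> = \<lparr> verts = verts G, mass = mass G, edges = edges G, weight = a \<beta> \<rparr>"
    and G\<beta>_graph: "\<And>\<beta>. \<beta> \<ge> 0 \<Longrightarrow> undirected_graph (G\<beta> \<beta>)"
    and G\<beta>_bounded: "\<And>\<beta>. \<beta> \<ge> 0 \<Longrightarrow> degree_bounded (G\<beta> \<beta>)"
    and a_0: "\<And>i j. i \<in> verts G \<Longrightarrow> j \<in> verts G \<Longrightarrow> a 0 i j = weight G i j"
    and a_const: "\<And>\<beta> \<beta>' i j. 0 \<le> \<beta> \<Longrightarrow> \<beta> < \<beta>' \<Longrightarrow> (i, j) \<in> edges G - Ehat \<Longrightarrow>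
      a \<beta>' i j = weight G i j"
    and a_increasing: "\<And>\<beta> \<beta>' i j. 0 \<le> \<beta> \<Longrightarrow> \<beta> < \<beta>' \<Longrightarrow> (i, j) \<in> Ehat \<Longrightarrow> a \<beta>' i j > a \<beta> i j"
    and a_diverges: "\<And>i j. (i, j) \<in> Ehat \<Longrightarrow> filterlim (\<lambda>\<beta>. a \<beta> i j) at_top at_top"
    and z: "z \<notin> complex_of_real ` {0..}"
  shows "(\<forall>\<beta>\<ge>0. z \<in> resolvent_set G (laplacian (G\<beta> \<beta>))) \<and>
    z \<in> resolvent_set (reduced_graph G Ehat) (laplacian (reduced_graph G Ehat)) \<and>
    strongly_converges G G
      (\<lambda>\<beta>. resolvent G (laplacian (G\<beta> \<beta>)) z)
      (J_up G Ehat \<circ> resolvent (reduced_graph G Ehat) (laplacian (reduced_graph G Ehat)) z \<circ> J_down G Ehat)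
      at_top"
proof -
  obtain K where "bounded_graph G K" using bounded_graph_if_undirected[OF G] .
  then interpret clustered_graph G K Ehat
    unfolding Ehat using G clusters
    by (intro clustered_graph_if_undirected_clusters) (auto simp: undirected_graph_def weighted_graph_def)
  obtain \<delta> \<omega> where \<delta>: "\<delta> > 0" and \<omega>: "cmod \<omega> = 1" and dir:
    "\<And>s r. 0 \<le> s \<Longrightarrow> 0 \<le> r \<Longrightarrow> \<delta> * r \<le> Re (\<omega> * (complex_of_real s - z * complex_of_real r))"
    using obtain_coercivity_direction[OF z] by metis
  have G\<beta>_sel: "verts (G\<beta> \<beta>) = verts G" "mass (G\<beta> \<beta>) = mass G" "weight (G\<beta> \<beta>) = a \<beta>" "edges (G\<beta> \<beta>) = edges G"
    if "\<beta> \<ge> 0" for \<beta>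
    using G\<beta>_eq[OF that] by auto
  have same: "ell2 (G\<beta> \<beta>) = ell2 G" "ell2_norm (G\<beta> \<beta>) = ell2_norm G"
    "ell2_inner (G\<beta> \<beta>) = ell2_inner G" "resolvent_set (G\<beta> \<beta>) = resolvent_set G"
    if "\<beta> \<ge> 0" for \<beta>
    by (rule ell2_cong[OF G\<beta>_sel(1,2)[OF that]])+
  let ?R = "\<lambda>\<beta>. resolvent G (laplacian (G\<beta> \<beta>)) z"
  have z_in: "z \<in> resolvent_set G (laplacian (G\<beta> \<beta>))" if \<beta>: "\<beta> \<ge> 0" for \<beta>
  proof -
    obtain K' where "bounded_graph (G\<beta> \<beta>) K'"
      using bounded_graph_if_undirected[OF G\<beta>_graph[OF \<beta>] G\<beta>_bounded[OF \<beta>]] .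
    from bounded_graph.in_resolvent_set[OF this \<delta> \<omega> dir] show ?thesis by (simp add: same[OF \<beta>])
  qed
  have z_in_reduced: "z \<in> resolvent_set reduced (laplacian reduced)"
    by (rule reduced.in_resolvent_set[OF \<delta> \<omega> dir])
  have bounded_R: "bounded_operator G G (?R \<beta>)" if "\<beta> \<ge> 0" for \<beta>
    using z_in[OF that] by (simp add: resolvent_set_def)
  note R = resolvent_in_ell2[OF z_in] shift_op_resolvent[OF z_in]
  \<comment> \<open>The degree bound \<open>K'\<close> varies with the parameter, but the estimate
    involves \<open>\<delta>\<close> only.\<close>
  have R_bound: "\<delta> * ell2_norm G (?R \<beta> w) \<le> ell2_norm G w" if \<beta>: "\<beta> \<ge> 0" and w: "w \<in> ell2 G" for \<beta> w
  proof -
    obtain K' where "bounded_graph (G\<beta> \<beta>) K'"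
      using bounded_graph_if_undirected[OF G\<beta>_graph[OF \<beta>] G\<beta>_bounded[OF \<beta>]] .
    from bounded_graph.shift_laplacian_lower_bound[OF this \<delta> \<omega> dir, of "?R \<beta> w"]
    show ?thesis using R[OF \<beta> w] by (simp add: same[OF \<beta>])
  qed
  \<comment> \<open>Weights change only on \<open>Ehat\<close>, and the two ends of such an edge lie
    in one cluster, where a lifted function takes equal values.\<close>
  have laplacian_J_up: "laplacian (G\<beta> \<beta>) (J_up G Ehat h) = laplacian G (J_up G Ehat h)"
    if \<beta>: "\<beta> \<ge> 0" and h: "h \<in> ell2 reduced" for \<beta> h
  proof
    fix x
    let ?u = "J_up G Ehat h"
    have u: "?u \<in> ell2 G" by (rule J_up_in_ell2[OF h])
    obtain K' where "bounded_graph (G\<beta> \<beta>) K'"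
      using bounded_graph_if_undirected[OF G\<beta>_graph[OF \<beta>] G\<beta>_bounded[OF \<beta>]] .
    then interpret b: bounded_graph "G\<beta> \<beta>" K' .
    have weight_eq: "complex_of_real (a \<beta> x y) * (?u x - ?u y) = complex_of_real (weight G x y) * (?u x - ?u y)"
      if xy: "x \<in> verts G" "y \<in> verts G" for y
    proof -
      consider "(x, y) \<in> Ehat" | "(x, y) \<in> edges G - Ehat" | "(x, y) \<notin> edges G" by auto
      then show ?thesis
      proof cases
        case 1
        then have "cluster x = cluster y" using cluster_eq_iff by auto
        then show ?thesis using xy by (simp add: J_up_eq)
      next
        case 2
        \<comment> \<open>Taking 0 as the smaller parameter in \<open>a_const\<close> covers
          positive \<open>\<beta>\<close>; for \<open>\<beta> = 0\<close> the weight is that of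
          \<open>G\<close> by \<open>a_0\<close>.\<close>
        then have "a \<beta> x y = weight G x y"
          using a_const[of 0 \<beta> x y] a_0[OF xy] \<beta> by (cases "\<beta> = 0") auto
        then show ?thesis by simp
      next
        case 3
        have "weight G x y = 0"
          using weight_eq_0_if_no_edge[of G x y] G(1) 3 xy by (simp add: undirected_graph_def)
        moreover have "a \<beta> x y = 0"
          using weight_eq_0_if_no_edge[of "G\<beta> \<beta>" x y] G\<beta>_graph[OF \<beta>] 3 xy
          by (simp add: undirected_graph_def G\<beta>_sel[OF \<beta>])
        ultimately show ?thesis by simp
      qed
    qed
    show "laplacian (G\<beta> \<beta>) ?u x = laplacian G ?u x"
    proof (cases "x \<in> verts G")
      case True
      have "laplacian (G\<beta> \<beta>) ?u x * complex_of_real (mass G x)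
          = (\<Sum>\<^sub>\<infinity>y\<in>verts G. complex_of_real (a \<beta> x y) * (?u x - ?u y))"
        using b.laplacian_mass[of ?u x] u True by (simp only: same[OF \<beta>] G\<beta>_sel[OF \<beta>])
      also have "\<dots> = (\<Sum>\<^sub>\<infinity>y\<in>verts G. complex_of_real (weight G x y) * (?u x - ?u y))"
        by (rule infsum_cong) (rule weight_eq[OF True])
      also have "\<dots> = laplacian G ?u x * complex_of_real (mass G x)"
        by (rule laplacian_mass[OF u True, symmetric])
      finally show ?thesis using mass_pos[OF True] by simp
    qed (simp add: laplacian_def G\<beta>_sel[OF \<beta>])
  qed
  have R_null: "((\<lambda>\<beta>. ell2_norm G (?R \<beta> w)) \<longlongrightarrow> 0) at_top"
    if w: "w \<in> ell2 G" "J_down G Ehat w = (\<lambda>_. 0)" for w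
  proof -
    \<comment> \<open>\<open>B\<close> is the resolvent bound at \<open>w\<close>. Solving the
      formula for the inner product of \<open>?R \<beta> w\<close> with \<open>w\<close> for the
      energy bounds the energy by \<open>M\<close>, independently of \<open>\<beta>\<close>.\<close>
    define B where "B = ell2_norm G w / \<delta>"
    define M where "M = 2 * (B * ell2_norm G w + cmod z * B\<^sup>2)"
    have v: "?R \<beta> w \<in> ell2 G" "ell2_norm G (?R \<beta> w) \<le> B" if "\<beta> \<ge> 0" for \<beta>
      using R(1)[OF that w(1)] R_bound[OF that w(1)] \<delta> by (auto simp: B_def field_simps)
    \<comment> \<open>Both come from the inner product of \<open>?R \<beta> w\<close> with
      \<open>w\<close>: rotated by \<open>\<omega>\<close> it gives coercivity, and its modulus
      gives the energy bound.\<close>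
    have key: "\<delta> * (ell2_norm G (?R \<beta> w))\<^sup>2 \<le> cmod (ell2_inner G w (?R \<beta> w))"
      "(i, j) \<in> Ehat \<Longrightarrow> a \<beta> i j * (cmod (?R \<beta> w i - ?R \<beta> w j))\<^sup>2 \<le> M"
      if \<beta>: "\<beta> \<ge> 0" for \<beta> i j
    proof -
      obtain K' where "bounded_graph (G\<beta> \<beta>) K'"
        using bounded_graph_if_undirected[OF G\<beta>_graph[OF \<beta>] G\<beta>_bounded[OF \<beta>]] .
      then interpret b: bounded_graph "G\<beta> \<beta>" K' .
      let ?v = "?R \<beta> w"
      have vb: "?v \<in> ell2 (G\<beta> \<beta>)" using v[OF \<beta>] by (simp add: same[OF \<beta>])
      have inner: "ell2_inner G ?v w = complex_of_real (b.energy ?v / 2) - z * complex_of_real ((ell2_norm G ?v)\<^sup>2)"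
        using b.ell2_inner_shift_laplacian[OF vb, of z] R(2)[OF \<beta> w(1)] by (simp add: same[OF \<beta>])
      have "\<delta> * (ell2_norm G ?v)\<^sup>2 \<le> Re (\<omega> * ell2_inner G ?v w)"
        unfolding inner by (rule dir) auto
      also have "\<dots> \<le> cmod (\<omega> * ell2_inner G ?v w)" by (rule complex_Re_le_cmod)
      also have "\<dots> = cmod (ell2_inner G w ?v)"
        by (subst ell2_inner_commute) (simp add: norm_mult \<omega>)
      finally show "\<delta> * (ell2_norm G ?v)\<^sup>2 \<le> cmod (ell2_inner G w ?v)" .
      have "b.energy ?v / 2 = cmod (complex_of_real (b.energy ?v / 2))"
        using b.energy_nonneg[of ?v] by simp
      also have "\<dots> = cmod (ell2_inner G ?v w + z * complex_of_real ((ell2_norm G ?v)\<^sup>2))"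
        unfolding inner by simp
      also have "\<dots> \<le> cmod (ell2_inner G ?v w) + cmod z * (ell2_norm G ?v)\<^sup>2"
        by (rule norm_triangle_le) (simp add: norm_mult norm_power)
      also have "\<dots> \<le> ell2_norm G ?v * ell2_norm G w + cmod z * (ell2_norm G ?v)\<^sup>2"
        using ell2_cauchy_schwarz[OF v(1)[OF \<beta>] w(1)] by simp
      also have "\<dots> \<le> B * ell2_norm G w + cmod z * B\<^sup>2"
        using v(2)[OF \<beta>] by (intro add_mono mult_left_mono mult_right_mono power_mono) auto
      finally have "b.energy ?v \<le> M" by (simp add: M_def)
      moreover assume "(i, j) \<in> Ehat"
      then have "i \<in> verts G" "j \<in> verts G" using F_subset by auto
      then have "a \<beta> i j * (cmod (?v i - ?v j))\<^sup>2 \<le> b.energy ?v"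
        using b.edge_le_energy[OF vb, of i j] by (simp add: G\<beta>_sel[OF \<beta>])
      ultimately show "a \<beta> i j * (cmod (?v i - ?v j))\<^sup>2 \<le> M" by linarith
    qed
    \<comment> \<open>The squared difference is squeezed below \<open>M / a \<beta> i j\<close>,
      whose denominator diverges.\<close>
    have edge: "((\<lambda>\<beta>. ?R \<beta> w i - ?R \<beta> w j) \<longlongrightarrow> 0) at_top" if ij: "(i, j) \<in> Ehat" for i j
    proof -
      have "((\<lambda>\<beta>. (cmod (?R \<beta> w i - ?R \<beta> w j))\<^sup>2) \<longlongrightarrow> 0) at_top"
      proof (rule tendsto_sandwich[OF _ _ tendsto_const])
        show "((\<lambda>\<beta>. M / a \<beta> i j) \<longlongrightarrow> 0) at_top"
          by (rule tendsto_divide_0[OF tendsto_const filterlim_at_top_imp_at_infinity[OF a_diverges[OF ij]]])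
        have "\<forall>\<^sub>F \<beta> in at_top. a \<beta> i j > 0"
          using a_diverges[OF ij] by (simp add: filterlim_at_top_dense)
        then show "\<forall>\<^sub>F \<beta> in at_top. (cmod (?R \<beta> w i - ?R \<beta> w j))\<^sup>2 \<le> M / a \<beta> i j"
          using eventually_ge_at_top[of 0]
        proof eventually_elim
          case (elim \<beta>)
          then show ?case using key(2)[OF elim(2) ij] by (simp add: field_simps)
        qed
      qed simp
      from tendsto_real_sqrt[OF this] show ?thesis by (simp add: tendsto_norm_zero_iff)
    qed
    have "\<forall>\<^sub>F \<beta> in at_top. ?R \<beta> w \<in> ell2 G \<and> ell2_norm G (?R \<beta> w) \<le> B"
      using eventually_ge_at_top[of 0] by eventually_elim (use v in auto)
    \<comment> \<open>Testing against \<open>w\<close> itself is enough, because coercivity bounds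
      the squared norm by this very inner product.\<close>
    from tendsto_ell2_inner_zero_average[OF this edge w]
    have "((\<lambda>\<beta>. cmod (ell2_inner G w (?R \<beta> w)) / \<delta>) \<longlongrightarrow> 0 / \<delta>) at_top"
      using \<delta> by (intro tendsto_divide tendsto_norm_zero tendsto_const) auto
    then have bound_null: "((\<lambda>\<beta>. cmod (ell2_inner G w (?R \<beta> w)) / \<delta>) \<longlongrightarrow> 0) at_top" by simp
    have "((\<lambda>\<beta>. (ell2_norm G (?R \<beta> w))\<^sup>2) \<longlongrightarrow> 0) at_top"
    proof (rule tendsto_sandwich[OF _ _ tendsto_const bound_null])
      show "\<forall>\<^sub>F \<beta> in at_top. (ell2_norm G (?R \<beta> w))\<^sup>2 \<le> cmod (ell2_inner G w (?R \<beta> w)) / \<delta>"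
        using eventually_ge_at_top[of 0]
      proof eventually_elim
        case (elim \<beta>)
        then show ?case using key(1)[OF elim] \<delta> by (simp add: field_simps)
      qed
    qed simp
    from tendsto_real_sqrt[OF this] show ?thesis by simp
  qed
  let ?Rr = "resolvent reduced (laplacian reduced) z"
  let ?S = "J_up G Ehat \<circ> ?Rr \<circ> J_down G Ehat"
  have Rr: "?Rr f \<in> ell2 reduced" "shift_op (laplacian reduced) z (?Rr f) = f" if "f \<in> ell2 reduced" for f
    using resolvent_in_ell2[OF z_in_reduced that] shift_op_resolvent[OF z_in_reduced that] by auto
  note pos = reduced.positive_masses_axioms
  have bounded_Rr: "bounded_operator reduced reduced ?Rr"
    using z_in_reduced by (simp add: resolvent_set_def)
  have "bounded_operator reduced G (J_up G Ehat \<circ> ?Rr)"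
    by (rule bounded_operator_comp[OF pos bounded_Rr bounded_operator_J_up])
  then have bounded_S: "bounded_operator G G ?S"
    by (rule bounded_operator_comp[OF pos bounded_operator_J_down])
  have "((\<lambda>\<beta>. ell2_norm G (\<lambda>x. ?R \<beta> f x - ?S f x)) \<longlongrightarrow> 0) at_top" if f: "f \<in> ell2 G" for f
  proof -
    \<comment> \<open>\<open>h\<close> solves the reduced equation, its lift \<open>u\<close> is the
      candidate limit, and \<open>w\<close> will be the residual of \<open>u\<close> in the original
      equation.\<close>
    define h where "h = ?Rr (J_down G Ehat f)"
    have h: "h \<in> ell2 reduced" "shift_op (laplacian reduced) z h = J_down G Ehat f"
      unfolding h_def using Rr J_down_in_ell2[OF f] by auto
    define u where "u = J_up G Ehat h"
    have u: "u \<in> ell2 G" unfolding u_def by (rule J_up_in_ell2[OF h(1)])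
    have Lu: "shift_op (laplacian G) z u \<in> ell2 G"
      unfolding shift_op_def by (intro ell2_diff ell2_scale laplacian_in_ell2 u)
    define w where "w = (\<lambda>x. f x - shift_op (laplacian G) z u x)"
    have w: "w \<in> ell2 G" unfolding w_def by (intro ell2_diff f Lu)
    \<comment> \<open>\<open>J_down\<close> after the Laplacian after \<open>J_up\<close> is the
      reduced Laplacian, and \<open>J_down\<close> after \<open>J_up\<close> is the identity, so the
      cluster averages of the residual vanish.\<close>
    have "J_down G Ehat (shift_op (laplacian G) z u) = shift_op (laplacian reduced) z h"
      unfolding shift_op_def bounded_operator_diff[OF bounded_operator_J_down laplacian_in_ell2[OF u] ell2_scale[OF u]]
        J_down_scale
      by (simp only: u_def J_down_laplacian_J_up[OF h(1)] J_down_J_up[OF h(1)])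
    then have "J_down G Ehat w = (\<lambda>_. 0)"
      unfolding w_def bounded_operator_diff[OF bounded_operator_J_down f Lu] h(2) by simp
    from R_null[OF w this] show ?thesis
    proof (rule Lim_transform_eventually)
      show "\<forall>\<^sub>F \<beta> in at_top. ell2_norm G (?R \<beta> w) = ell2_norm G (\<lambda>x. ?R \<beta> f x - ?S f x)"
        using eventually_ge_at_top[of 0]
      proof eventually_elim
        case (elim \<beta>)
        \<comment> \<open>As the Laplacians agree on \<open>u\<close>, each resolvent returns
          \<open>u\<close> from \<open>shift_op (laplacian G) z u\<close>; applied to the residual
          it therefore gives the difference to be estimated.\<close>
        have eq: "shift_op (laplacian (G\<beta> \<beta>)) z u = shift_op (laplacian G) z u"
          unfolding shift_op_def u_def laplacian_J_up[OF elim h(1)] ..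
        have "?R \<beta> w = (\<lambda>x. ?R \<beta> f x - ?R \<beta> (shift_op (laplacian G) z u) x)"
          unfolding w_def by (rule bounded_operator_diff[OF bounded_R[OF elim] f Lu])
        also have "?R \<beta> (shift_op (laplacian G) z u) = u"
          by (rule resolvent_eqI[OF z_in[OF elim] u eq])
        finally show ?case by (simp add: u_def h_def)
      qed
    qed
  qed
  moreover have "\<forall>\<^sub>F \<beta> in at_top. bounded_operator G G (?R \<beta>)"
    using eventually_ge_at_top[of 0] by eventually_elim (rule bounded_R)
  ultimately show ?thesis
    using z_in z_in_reduced bounded_S unfolding strongly_converges_def by blast
qed

end
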